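(* Let $(K,v_0)$ be a valued field and let $K(x)$ be the rational function field in one variable over $K$. Then for every non-trivial approximation type $\mathbf{A}$ over $(K,v_0)$ there is an extension $v$ of $v_0$ to $K(x)$ such that $\mathrm{appr}_v(x,K)=\mathbf{A}$. In other words, if $\mathcal V$ denotes the set of all extensions of $v_0$ to $K(x)$ and $\mathcal A$ the set of all non-trivial approximation types over $(K,v_0)$, then the function $\mathcal V\to\mathcal A$, $v\mapsto \mathrm{appr}_v(x,K)$, is surjective.
   Context: Valuations are Krull valuations written additively; $vK$ is the value group and $\infty$ is larger than all values. Extensions of $v_0$ are identified when they are equivalent over $v_0$ (differ by an order preserving isomorphism of value groups that is the identity on $v_0K$). Balls: for $c\in K$, the closed ball of radius $\gamma\in vK\cup\{\infty\}$ is $B_\gamma(c,K)=\{a\in K\mid v(a-c)\ge\gamma\}$, and the open ball of radius $\gamma\in vK$ is $B^\circ_\gamma(c,K)=\{a\in K\mid v(a-c)>\gamma\}$. Balls are recorded together with their radius and their kind (open/closed). An approximation type $\mathbf A$ over $(K,v)$ is a (possibly empty) collection of closed and open balls in $(K,v)$, any two of which are comparable by inclusion, such that whenever $\mathbf A$ contains a (closed or open) ball with center $c$ and radius $\gamma$, it contains $B_\beta(c,K)$ and $B_\beta^\circ(c,K)$ for all $\beta\in vK$ with $\beta<\gamma$, and whenever it contains $B^\circ_\gamma(c,K)$ it contains $B_\gamma(c,K)$. Its support $\mathrm{supp}\,\mathbf A$ is the set of all $\gamma\in vK\cup\{\infty\}$ such that $\mathbf A$ contains a closed ball of radius $\gamma$.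 $\mathbf A$ is trivial if $\infty\in\mathrm{supp}\,\mathbf A$ (equivalently, $\mathbf A=\mathrm{appr}_v(c,K)$ for some $c\in K$). For an extension $(L|K,v)$ of valued fields and $x\in L$, $\mathrm{appr}_v(x,K)$ is the approximation type over $(K,v)$ consisting of all nonempty sets $\{c\in K\mid v(x-c)\ge\gamma\}$, $\gamma\in vK\cup\{\infty\}$ (as closed balls of radius $\gamma$), and all nonempty sets $\{c\in K\mid v(x-c)>\gamma\}$, $\gamma\in vK$ (as open balls of radius $\gamma$). *)

theory Defs
  imports
    "HOL-Algebra.Group"
    "HOL-Computational_Algebra.Computational_Algebra"
begin

section \<open>Ordered abelian groups\<close>

text \<open>
  The value group of an extension is existentially quantified in the main statement, so ordered
  abelian groups are structures with an explicit carrier instead of instances of a type class.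
  They reuse the group record of HOL-Algebra: the group operation, which is addition in the usual
  valuation-theoretic notation, appears as \<open>\<otimes>\<close> and the zero element as \<open>\<one>\<close>.
\<close>

record 'g ogroup = "'g monoid" +
  gle :: "'g \<Rightarrow> 'g \<Rightarrow> bool"

locale ordered_abelian_group = comm_group G for G :: "'g ogroup" (structure) +
  assumes gle_linear:
      "linear_order_on (carrier G) {(\<alpha>, \<beta>) \<in> carrier G \<times> carrier G. gle G \<alpha> \<beta>}"
    and gle_translate:
      "\<lbrakk>\<alpha> \<in> carrier G; \<beta> \<in> carrier G; \<gamma> \<in> carrier G; gle G \<alpha> \<beta>\<rbrakk>
        \<Longrightarrow> gle G (\<alpha> \<otimes> \<gamma>) (\<beta> \<otimes> \<gamma>)"

definition ord_embeddings :: "'g ogroup \<Rightarrow> 'h ogroup \<Rightarrow> ('g \<Rightarrow> 'h) set" where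
  "ord_embeddings G H =
    {f \<in> hom G H. inj_on f (carrier G) \<and>
       (\<forall>\<alpha>\<in>carrier G. \<forall>\<beta>\<in>carrier G. gle G \<alpha> \<beta> \<longleftrightarrow> gle H (f \<alpha>) (f \<beta>))}"

definition ord_isos :: "'g ogroup \<Rightarrow> 'h ogroup \<Rightarrow> ('g \<Rightarrow> 'h) set" where
  "ord_isos G H = iso G H \<inter> ord_embeddings G H"


section \<open>Krull valuations\<close>

datatype 'g ext_val = Fin 'g | Infty

fun vadd :: "'g ogroup \<Rightarrow> 'g ext_val \<Rightarrow> 'g ext_val \<Rightarrow> 'g ext_val" where
  "vadd G (Fin \<alpha>) (Fin \<beta>) = Fin (\<alpha> \<otimes>\<^bsub>G\<^esub> \<beta>)"
| "vadd G _ _ = Infty"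

fun vle :: "'g ogroup \<Rightarrow> 'g ext_val \<Rightarrow> 'g ext_val \<Rightarrow> bool" where
  "vle G _ Infty = True"
| "vle G Infty (Fin \<beta>) = False"
| "vle G (Fin \<alpha>) (Fin \<beta>) = gle G \<alpha> \<beta>"

definition vless :: "'g ogroup \<Rightarrow> 'g ext_val \<Rightarrow> 'g ext_val \<Rightarrow> bool" where
  "vless G a b \<longleftrightarrow> vle G a b \<and> a \<noteq> b"

definition vmin :: "'g ogroup \<Rightarrow> 'g ext_val \<Rightarrow> 'g ext_val \<Rightarrow> 'g ext_val" where
  "vmin G a b = (if vle G a b then a else b)"

text \<open>
  The ambient group \<open>G\<close> may be larger than the value group \<open>vK\<close>, which is defined below.
\<close>

locale krull_valuation = ordered_abelian_group G
  for G :: "'g ogroup" and v :: "'k::field \<Rightarrow> 'g ext_val" +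
  assumes val_closed: "v a = Fin \<gamma> \<Longrightarrow> \<gamma> \<in> carrier G"
    and val_infty_iff: "v a = Infty \<longleftrightarrow> a = 0"
    and val_mult: "v (a * b) = vadd G (v a) (v b)"
    and val_add: "vle G (vmin G (v a) (v b)) (v (a + b))"

definition value_group :: "'g ogroup \<Rightarrow> ('k::field \<Rightarrow> 'g ext_val) \<Rightarrow> 'g ogroup" where
  "value_group G v = G\<lparr>carrier := {\<gamma>. \<exists>a. v a = Fin \<gamma>}\<rparr>"

definition radii :: "'g ogroup \<Rightarrow> ('k::field \<Rightarrow> 'g ext_val) \<Rightarrow> 'g ext_val set" where
  "radii G v = Fin ` carrier (value_group G v) \<union> {Infty}"


section \<open>Balls and approximation types\<close>

text \<open>A ball is recorded together with its kind and its radius.\<close>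

datatype ('g, 'k) ball =
    ClosedBall "'g ext_val" (points: "'k set")
  | OpenBall 'g (points: "'k set")

definition closed_ball ::
    "'g ogroup \<Rightarrow> ('k::field \<Rightarrow> 'g ext_val) \<Rightarrow> 'g ext_val \<Rightarrow> 'k \<Rightarrow> ('g, 'k) ball" where
  "closed_ball G v \<gamma> c = ClosedBall \<gamma> {a. vle G \<gamma> (v (a - c))}"

definition open_ball ::
    "'g ogroup \<Rightarrow> ('k::field \<Rightarrow> 'g ext_val) \<Rightarrow> 'g \<Rightarrow> 'k \<Rightarrow> ('g, 'k) ball" where
  "open_ball G v \<gamma> c = OpenBall \<gamma> {a. vless G (Fin \<gamma>) (v (a - c))}"

definition balls :: "'g ogroup \<Rightarrow> ('k::field \<Rightarrow> 'g ext_val) \<Rightarrow> ('g, 'k) ball set" where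
  "balls G v =
     {closed_ball G v \<gamma> c |\<gamma> c. \<gamma> \<in> radii G v} \<union>
     {open_ball G v \<gamma> c |\<gamma> c. \<gamma> \<in> carrier (value_group G v)}"

definition approximation_type ::
    "'g ogroup \<Rightarrow> ('k::field \<Rightarrow> 'g ext_val) \<Rightarrow> ('g, 'k) ball set \<Rightarrow> bool" where
  "approximation_type G v A \<longleftrightarrow>
     A \<subseteq> balls G v \<and>
     (\<forall>B\<in>A. \<forall>B'\<in>A. points B \<subseteq> points B' \<or> points B' \<subseteq> points B) \<and>
     (\<forall>\<gamma>\<in>radii G v. \<forall>c. closed_ball G v \<gamma> c \<in> A \<longrightarrow>
        (\<forall>\<beta>\<in>carrier (value_group G v). vless G (Fin \<beta>) \<gamma> \<longrightarrow>
           closed_ball G v (Fin \<beta>) c \<in> A \<and> open_ball G v \<beta> c \<in> A)) \<and>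
     (\<forall>\<gamma>\<in>carrier (value_group G v). \<forall>c. open_ball G v \<gamma> c \<in> A \<longrightarrow>
        (\<forall>\<beta>\<in>carrier (value_group G v). vless G (Fin \<beta>) (Fin \<gamma>) \<longrightarrow>
           closed_ball G v (Fin \<beta>) c \<in> A \<and> open_ball G v \<beta> c \<in> A) \<and>
        closed_ball G v (Fin \<gamma>) c \<in> A)"

definition supp :: "('g, 'k) ball set \<Rightarrow> 'g ext_val set" where
  "supp A = {\<gamma>. \<exists>S. ClosedBall \<gamma> S \<in> A}"

definition trivial_appr_type :: "('g, 'k) ball set \<Rightarrow> bool" where
  "trivial_appr_type A \<longleftrightarrow> Infty \<in> supp A"

definition nontrivial_appr_types ::
    "'g ogroup \<Rightarrow> ('k::field \<Rightarrow> 'g ext_val) \<Rightarrow> ('g, 'k) ball set set" where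
  "nontrivial_appr_types G v = {A. approximation_type G v A \<and> \<not> trivial_appr_type A}"


section \<open>Extensions of valuations\<close>

text \<open>
  An extension of \<open>v0\<close> along a field embedding \<open>\<iota>\<close> consists of a valuation on the larger field
  together with the ordered group embedding \<open>emb\<close> of value groups that plays the role of the
  inclusion of \<open>v0 K\<close> in \<open>v L\<close>.
\<close>

record ('l, 'g, 'h) val_ext =
  grp :: "'h ogroup"
  emb :: "'g \<Rightarrow> 'h"
  val :: "'l \<Rightarrow> 'h ext_val"

definition field_embedding :: "('k::field \<Rightarrow> 'l::field) \<Rightarrow> bool" where
  "field_embedding \<iota> \<longleftrightarrow>
     \<iota> 1 = 1 \<and> (\<forall>a b. \<iota> (a + b) = \<iota> a + \<iota> b) \<and> (\<forall>a b. \<iota> (a * b) = \<iota> a * \<iota> b)"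

definition val_extension ::
    "'g ogroup \<Rightarrow> ('k::field \<Rightarrow> 'g ext_val) \<Rightarrow> ('k \<Rightarrow> 'l::field) \<Rightarrow> ('l, 'g, 'h) val_ext \<Rightarrow> bool" where
  "val_extension G v0 \<iota> E \<longleftrightarrow>
     field_embedding \<iota> \<and>
     krull_valuation (grp E) (val E) \<and>
     emb E \<in> ord_embeddings (value_group G v0) (value_group (grp E) (val E)) \<and>
     (\<forall>a. val E (\<iota> a) = map_ext_val (emb E) (v0 a))"

definition equivalent_over ::
    "'g ogroup \<Rightarrow> ('k::field \<Rightarrow> 'g ext_val) \<Rightarrow>
     ('l::field, 'g, 'h) val_ext \<Rightarrow> ('l, 'g, 'h) val_ext \<Rightarrow> bool" where
  "equivalent_over G v0 E E' \<longleftrightarrow>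
     (\<exists>\<phi> \<in> ord_isos (value_group (grp E) (val E)) (value_group (grp E') (val E')).
        (\<forall>\<gamma>\<in>carrier (value_group G v0). \<phi> (emb E \<gamma>) = emb E' \<gamma>) \<and>
        (\<forall>z. val E' z = map_ext_val \<phi> (val E z)))"

definition appr ::
    "'g ogroup \<Rightarrow> ('k::field \<Rightarrow> 'g ext_val) \<Rightarrow> ('k \<Rightarrow> 'l::field) \<Rightarrow>
     ('l, 'g, 'h) val_ext \<Rightarrow> 'l \<Rightarrow> ('g, 'k) ball set" where
  "appr G v0 \<iota> E x =
     {ClosedBall \<gamma> S |\<gamma> S. \<gamma> \<in> radii G v0 \<and> S \<noteq> {} \<and>
        S = {c. vle (grp E) (map_ext_val (emb E) \<gamma>) (val E (x - \<iota> c))}} \<union>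
     {OpenBall \<gamma> S |\<gamma> S. \<gamma> \<in> carrier (value_group G v0) \<and> S \<noteq> {} \<and>
        S = {c. vless (grp E) (Fin (emb E \<gamma>)) (val E (x - \<iota> c))}}"


section \<open>The rational function field\<close>

definition ratfun_const :: "'k::field \<Rightarrow> 'k poly fract" where
  "ratfun_const c = to_fract [:c:]"

definition ratfun_X :: "'k::field poly fract" where
  "ratfun_X = to_fract [:0, 1:]"

text \<open>
  Value groups of extensions to \<open>K(x)\<close> live in the type of sets of rational functions. This loses
  no extension up to equivalence: if \<open>v\<close> is a valuation on \<open>K(x)\<close> with values in any ordered
  abelian group, its value group is isomorphic to the group of cosets of \<open>{z. v z = 0}\<close> in the
  multiplicative group of \<open>K(x)\<close>.
\<close>

type_synonym ('k, 'g) ratfun_ext = "('k poly fract, 'g, 'k poly fract set) val_ext"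

definition ratfun_extensions ::
    "'g ogroup \<Rightarrow> ('k::field \<Rightarrow> 'g ext_val) \<Rightarrow> ('k, 'g) ratfun_ext set" where
  "ratfun_extensions G v0 = {E. val_extension G v0 ratfun_const E}"

definition ratfun_ext_equiv ::
    "'g ogroup \<Rightarrow> ('k::field \<Rightarrow> 'g ext_val) \<Rightarrow>
     (('k, 'g) ratfun_ext \<times> ('k, 'g) ratfun_ext) set" where
  "ratfun_ext_equiv G v0 =
     {(E, E'). E \<in> ratfun_extensions G v0 \<and> E' \<in> ratfun_extensions G v0 \<and>
        equivalent_over G v0 E E'}"

definition ratfun_appr ::
    "'g ogroup \<Rightarrow> ('k::field \<Rightarrow> 'g ext_val) \<Rightarrow> ('k, 'g) ratfun_ext \<Rightarrow> ('g, 'k) ball set" where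
  "ratfun_appr G v0 E = appr G v0 ratfun_const E ratfun_X"

end

theory Submission
  imports Defs
begin

text \<open>
  Up to equivalence a valuation \<open>v\<close> is the same thing as the relation \<open>v a \<le> v b\<close>. Working with this
  relation makes the value group disappear from the construction: on a domain one only needs a
  total preorder compatible with multiplication and addition (\<open>valuation_preorder\<close>), and on a field
  the value group can be recovered as the group of classes of nonzero elements of equal value
  (\<open>krull_valuation_class_val\<close>). Such a preorder on \<open>K[x]\<close> passes to \<open>K(x)\<close> by common denominators
  (\<open>valuation_preorder_fract_le\<close>).

  The approximation type of \<open>x\<close> is determined by the answers to the questions \<open>v r \<le> v (x - c)\<close> and
  \<open>v (x - c) \<le> v r\<close> for \<open>c\<close>, \<open>r\<close> in \<open>K\<close>: the first holds exactly if the closed ball of radius \<open>v r\<close>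
  around \<open>c\<close> belongs to the approximation type, the second fails exactly if the open one does. So
  an approximation type \<open>A\<close> prescribes infinitely many conditions on a preorder on \<open>K[x]\<close>.

  A single ball of \<open>A\<close> has an obvious valuation: for the closed ball around \<open>c\<close> with radius \<open>v r\<close> it
  is the Gauss valuation in the variable \<open>(x - c) / r\<close>, and for the open ball the same, except that
  this variable receives an infinitesimal positive value instead of the value zero. This
  valuation satisfies every condition by which a ball outside \<open>A\<close> is excluded, and it satisfies the
  conditions imposed by all members of \<open>A\<close> whose radius is not larger. Since the members of \<open>A\<close>
  form a chain, the conditions of \<open>A\<close> therefore hold eventually along this chain. An ultrafilter
  on the chain turns the family into one preorder (\<open>valuation_preorder_ultralimit\<close>): all axioms
  of a valuation preorder are inherited, and so is each of the conditions
  (\<open>exists_realizing_order\<close>). This treats chains with and without a smallest ball and with empty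
  or nonempty intersection uniformly, and in particular no distinction between algebraic and
  transcendental limits arises. Only the empty approximation type is separate; it belongs to the
  valuation for which \<open>x\<close> has smaller value than every constant.

  For surjectivity on equivalence classes it remains to see that conversely the approximation type
  of \<open>x\<close> satisfies the axioms, which comes from the same description by questions, and that equivalent
  extensions give the same answers.
\<close>

section \<open>Valuation preorders\<close>

text \<open>
  The relation \<open>a \<preceq> b\<close> stands for \<open>v a \<le> v b\<close>, so that \<open>0\<close> is the largest element and \<open>\<not> b \<preceq> a\<close>
  is the strict inequality \<open>v a < v b\<close>. The axioms are universal statements about \<open>\<preceq>\<close>, which is
  what lets them survive passage to an ultralimit.
\<close>

locale valuation_preorder =
  fixes R :: "'a::idom \<Rightarrow> 'a \<Rightarrow> bool" (infix "\<preceq>" 50)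
  assumes le_total: "a \<preceq> b \<or> b \<preceq> a"
    and le_trans: "a \<preceq> b \<Longrightarrow> b \<preceq> c \<Longrightarrow> a \<preceq> c"
    and le_zero: "a \<preceq> 0"
    and zero_le: "0 \<preceq> a \<Longrightarrow> a = 0"
    and le_mult_cancel: "c \<noteq> 0 \<Longrightarrow> a * c \<preceq> b * c \<longleftrightarrow> a \<preceq> b"
    and le_add: "c \<preceq> a \<Longrightarrow> c \<preceq> b \<Longrightarrow> c \<preceq> a + b"
begin

lemma le_refl: "a \<preceq> a"
  using le_total by blast

lemma le_mult_right: "a \<preceq> b \<Longrightarrow> a * c \<preceq> b * c"
  using le_mult_cancel le_zero by (cases "c = 0") auto

lemma le_mult: "a \<preceq> b \<Longrightarrow> c \<preceq> d \<Longrightarrow> a * c \<preceq> b * d"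
  by (metis le_mult_right le_trans mult.commute)

text \<open>
  The element \<open>- 1\<close> has value zero because its square is \<open>1\<close>.
\<close>

lemma le_uminus: "a \<preceq> - a"
proof -
  have "1 \<preceq> - 1"
    using le_total[of 1 "- 1"] le_mult_right[of "- 1" 1 "- 1"] by auto
  from le_mult_right[OF this, of a] show ?thesis by simp
qed

lemma le_uminus_iff: "a \<preceq> - b \<longleftrightarrow> a \<preceq> b"
  by (metis le_trans le_uminus minus_minus)

lemma uminus_le_iff: "- a \<preceq> b \<longleftrightarrow> a \<preceq> b"
  by (metis le_trans le_uminus minus_minus)

lemma le_diff: "c \<preceq> a \<Longrightarrow> c \<preceq> b \<Longrightarrow> c \<preceq> a - b"
  using le_add[of c a "- b"] by (simp add: le_uminus_iff)

lemma less_add: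
  assumes "\<not> a \<preceq> c" "\<not> b \<preceq> c"
  shows "\<not> a + b \<preceq> c"
  using assms le_total[of a b] le_add[of a a b] le_add[of b a b] le_refl le_trans by blast

lemma less_diff:
  assumes "\<not> a \<preceq> c" "\<not> b \<preceq> c"
  shows "\<not> a - b \<preceq> c"
  using less_add[of a c "- b"] assms by (simp add: uminus_le_iff)

lemma le_diff_iff: "s \<preceq> w \<Longrightarrow> s \<preceq> u - w \<longleftrightarrow> s \<preceq> u"
  using le_add[of s "u - w" w] le_diff by auto

lemma le_diff_iff': "s \<preceq> w \<Longrightarrow> s \<preceq> w - u \<longleftrightarrow> s \<preceq> u"
  using le_diff_iff[of s w u] le_uminus_iff[of s "u - w"] by simp

lemma diff_le_iff: "\<not> w \<preceq> s \<Longrightarrow> u - w \<preceq> s \<longleftrightarrow> u \<preceq> s"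
  using less_add[of "u - w" s w] less_diff by auto

lemma diff_le_iff': "\<not> w \<preceq> s \<Longrightarrow> w - u \<preceq> s \<longleftrightarrow> u \<preceq> s"
  using diff_le_iff[of w s u] uminus_le_iff[of "u - w" s] by simp

lemma minus_swap_le: "a - b \<preceq> s \<longleftrightarrow> b - a \<preceq> s"
  using uminus_le_iff[of "a - b" s] by simp

lemma le_minus_swap: "s \<preceq> a - b \<longleftrightarrow> s \<preceq> b - a"
  using le_uminus_iff[of s "a - b"] by simp

end

context krull_valuation
begin

lemma gle_total: "\<alpha> \<in> carrier G \<Longrightarrow> \<beta> \<in> carrier G \<Longrightarrow> gle G \<alpha> \<beta> \<or> gle G \<beta> \<alpha>"
  and gle_antisym:
    "\<alpha> \<in> carrier G \<Longrightarrow> \<beta> \<in> carrier G \<Longrightarrow> gle G \<alpha> \<beta> \<Longrightarrow> gle G \<beta> \<alpha> \<Longrightarrow> \<alpha> = \<beta>"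
  and gle_trans:
    "\<alpha> \<in> carrier G \<Longrightarrow> \<beta> \<in> carrier G \<Longrightarrow> \<gamma> \<in> carrier G \<Longrightarrow>
      gle G \<alpha> \<beta> \<Longrightarrow> gle G \<beta> \<gamma> \<Longrightarrow> gle G \<alpha> \<gamma>"
proof -
  have refl: "gle G \<alpha> \<alpha>" if "\<alpha> \<in> carrier G" for \<alpha>
    using gle_linear that by (auto simp: order_on_defs refl_on_def)
  show "gle G \<alpha> \<beta> \<or> gle G \<beta> \<alpha>" if "\<alpha> \<in> carrier G" "\<beta> \<in> carrier G"
    using gle_linear that refl by (cases "\<alpha> = \<beta>") (auto simp: order_on_defs total_on_def)
  show "\<alpha> = \<beta>" if "\<alpha> \<in> carrier G" "\<beta> \<in> carrier G" "gle G \<alpha> \<beta>" "gle G \<beta> \<alpha>"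
    using gle_linear that by (auto simp: order_on_defs antisym_def)
  show "gle G \<alpha> \<gamma>" if "\<alpha> \<in> carrier G" "\<beta> \<in> carrier G" "\<gamma> \<in> carrier G"
    "gle G \<alpha> \<beta>" "gle G \<beta> \<gamma>"
    using gle_linear that unfolding order_on_defs trans_def by blast
qed

lemma gle_translate_iff:
  assumes "\<alpha> \<in> carrier G" "\<beta> \<in> carrier G" "\<gamma> \<in> carrier G"
  shows "gle G (\<alpha> \<otimes>\<^bsub>G\<^esub> \<gamma>) (\<beta> \<otimes>\<^bsub>G\<^esub> \<gamma>) \<longleftrightarrow> gle G \<alpha> \<beta>"
proof
  assume "gle G (\<alpha> \<otimes>\<^bsub>G\<^esub> \<gamma>) (\<beta> \<otimes>\<^bsub>G\<^esub> \<gamma>)"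
  then have "gle G (\<alpha> \<otimes>\<^bsub>G\<^esub> \<gamma> \<otimes>\<^bsub>G\<^esub> inv\<^bsub>G\<^esub> \<gamma>) (\<beta> \<otimes>\<^bsub>G\<^esub> \<gamma> \<otimes>\<^bsub>G\<^esub> inv\<^bsub>G\<^esub> \<gamma>)"
    using assms by (simp add: gle_translate)
  then show "gle G \<alpha> \<beta>"
    using assms by (simp add: m_assoc)
qed (use assms gle_translate in blast)

lemma valuation_preorder_val: "valuation_preorder (\<lambda>a b. vle G (v a) (v b))"
proof
  have [simp]: "v 0 = Infty" by (simp add: val_infty_iff)
  have fin: "\<exists>\<gamma>\<in>carrier G. v a = Fin \<gamma>" if "a \<noteq> 0" for a
    using that val_infty_iff[of a] val_closed[of a] by (cases "v a") auto
  show "vle G (v a) (v b) \<or> vle G (v b) (v a)" for a b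
    using gle_total val_closed[of a] val_closed[of b] by (cases "v a"; cases "v b") auto
  show trans: "vle G (v a) (v c)" if "vle G (v a) (v b)" "vle G (v b) (v c)" for a b c
    using that val_closed[of a] val_closed[of b] val_closed[of c]
    by (cases "v a"; cases "v b"; cases "v c") (auto intro: gle_trans)
  show "vle G (v a) (v 0)" for a by simp
  show "a = 0" if "vle G (v 0) (v a)" for a
    using that val_infty_iff[of a] by (cases "v a") auto
  show "vle G (v (a * c)) (v (b * c)) \<longleftrightarrow> vle G (v a) (v b)" if "c \<noteq> 0" for a b c
    using fin[OF that] gle_translate_iff val_closed
    by (cases "v a"; cases "v b") (auto simp: val_mult)
  show "vle G (v c) (v (a + b))" if "vle G (v c) (v a)" "vle G (v c) (v b)" for a b c
    using val_add[of a b] that trans[of c _ "a + b"] unfolding vmin_def by (auto split: if_splits)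
qed

lemma vle_antisym: "vle G (v a) (v b) \<Longrightarrow> vle G (v b) (v a) \<Longrightarrow> v a = v b"
  using gle_antisym val_closed by (cases "v a"; cases "v b") auto

lemma vless_iff: "vless G (v a) (v b) \<longleftrightarrow> \<not> vle G (v b) (v a)"
proof -
  interpret D: valuation_preorder "\<lambda>a b. vle G (v a) (v b)" by (rule valuation_preorder_val)
  show ?thesis unfolding vless_def using vle_antisym D.le_total D.le_refl by metis
qed

lemma radii_eq_range: "radii G v = range v"
proof -
  have "v 0 = Infty" by (simp add: val_infty_iff)
  then show ?thesis
    unfolding radii_def value_group_def
    by (auto simp: image_iff) (metis ext_val.exhaust)+
qed

lemma balls_cases:
  assumes "B \<in> balls G v"
  obtains (closed) r c where "B = closed_ball G v (v r) c"
    | (opened) r \<gamma> c where "B = open_ball G v \<gamma> c" "v r = Fin \<gamma>"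
  using assms by (auto simp: balls_def radii_eq_range value_group_def)

end

definition value_class :: "('a \<Rightarrow> 'a \<Rightarrow> bool) \<Rightarrow> 'a \<Rightarrow> 'a set" where
  "value_class R z = {w. R z w \<and> R w z}"

text \<open>
  A field element \<open>w\<close> lies in \<open>value_class R z\<close> iff \<open>w\<close> and \<open>z\<close> have the same value, so for nonzero \<open>z\<close>
  the class is the coset of \<open>z\<close> modulo the units of the valuation ring. Product and order are formed
  from representatives; \<open>class_group R\<close> is the value group of \<open>R\<close>.
\<close>

definition class_group :: "('a::field \<Rightarrow> 'a \<Rightarrow> bool) \<Rightarrow> 'a set ogroup" where
  "class_group R =
    \<lparr>carrier = value_class R ` {z. z \<noteq> 0},
     monoid.mult = (\<lambda>A B. \<Union>a\<in>A. \<Union>b\<in>B. value_class R (a * b)),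
     monoid.one = value_class R 1,
     gle = (\<lambda>A B. \<exists>a\<in>A. \<exists>b\<in>B. R a b)\<rparr>"

definition class_val :: "('a::field \<Rightarrow> 'a \<Rightarrow> bool) \<Rightarrow> 'a \<Rightarrow> 'a set ext_val" where
  "class_val R z = (if z = 0 then Infty else Fin (value_class R z))"

locale field_valuation_preorder = valuation_preorder R
  for R :: "'a::field \<Rightarrow> 'a \<Rightarrow> bool" (infix "\<preceq>" 50)
begin

lemma value_class_eq_iff: "value_class R z = value_class R w \<longleftrightarrow> z \<preceq> w \<and> w \<preceq> z"
  unfolding value_class_def using le_refl le_trans by blast

lemma value_class_mult:
  "value_class R z \<otimes>\<^bsub>class_group R\<^esub> value_class R w = value_class R (z * w)"
proof -
  have "value_class R (a * b) = value_class R (z * w)"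
    if "a \<in> value_class R z" "b \<in> value_class R w" for a b
    using that unfolding value_class_eq_iff by (auto simp: value_class_def intro: le_mult)
  moreover have "z \<in> value_class R z" "w \<in> value_class R w"
    by (auto simp: value_class_def le_refl)
  ultimately have "(\<Union>a\<in>value_class R z. \<Union>b\<in>value_class R w. value_class R (a * b)) =
      value_class R (z * w)"
    by blast
  then show ?thesis by (simp add: class_group_def)
qed

lemma gle_value_class: "gle (class_group R) (value_class R z) (value_class R w) \<longleftrightarrow> z \<preceq> w"
proof -
  have "gle (class_group R) (value_class R z) (value_class R w) \<longleftrightarrow>
      (\<exists>a\<in>value_class R z. \<exists>b\<in>value_class R w. a \<preceq> b)"
    by (simp add: class_group_def)
  also have "\<dots> \<longleftrightarrow> z \<preceq> w"
    unfolding value_class_def using le_refl le_trans by blast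
  finally show ?thesis .
qed

lemma class_group_sel:
  "carrier (class_group R) = value_class R ` {z. z \<noteq> 0}"
  "\<one>\<^bsub>class_group R\<^esub> = value_class R 1"
  by (simp_all add: class_group_def)

lemma ordered_abelian_group_class_group: "ordered_abelian_group (class_group R)"
proof (intro ordered_abelian_group.intro comm_groupI ordered_abelian_group_axioms.intro)
  fix A assume "A \<in> carrier (class_group R)"
  then obtain z where z: "z \<noteq> 0" "A = value_class R z" by (auto simp: class_group_sel)
  then show "\<exists>B\<in>carrier (class_group R). B \<otimes>\<^bsub>class_group R\<^esub> A = \<one>\<^bsub>class_group R\<^esub>"
    by (intro bexI[of _ "value_class R (inverse z)"])
      (auto simp: class_group_sel value_class_mult)
next
  show "linear_order_on (carrier (class_group R))
    {(A, B) \<in> carrier (class_group R) \<times> carrier (class_group R). gle (class_group R) A B}"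
    unfolding order_on_defs
  proof (intro conjI)
    show "trans {(A, B) \<in> carrier (class_group R) \<times> carrier (class_group R).
        gle (class_group R) A B}"
      by (rule transI) (auto simp: class_group_sel gle_value_class intro: le_trans)
    show "antisym {(A, B) \<in> carrier (class_group R) \<times> carrier (class_group R).
        gle (class_group R) A B}"
      by (rule antisymI) (clarsimp simp: class_group_sel gle_value_class value_class_eq_iff)
    show "total_on (carrier (class_group R)) {(A, B) \<in> carrier (class_group R) \<times>
        carrier (class_group R). gle (class_group R) A B}"
      using le_total by (auto simp: total_on_def class_group_sel gle_value_class)
  qed (auto simp: class_group_sel gle_value_class le_refl refl_on_def)
qed (auto simp: class_group_sel value_class_mult gle_value_class le_mult_right ac_simps)

lemma vle_class_val: "vle (class_group R) (class_val R z) (class_val R w) \<longleftrightarrow> z \<preceq> w"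
  using le_zero zero_le by (auto simp: class_val_def gle_value_class)

lemma krull_valuation_class_val: "krull_valuation (class_group R) (class_val R)"
proof (intro krull_valuation.intro ordered_abelian_group_class_group krull_valuation_axioms.intro)
  show "vle (class_group R) (vmin (class_group R) (class_val R a) (class_val R b))
      (class_val R (a + b))" for a b
    using le_total[of a b] le_add[of a a b] le_add[of b a b] le_refl
    by (auto simp: vmin_def vle_class_val)
qed (auto simp: class_val_def class_group_sel value_class_mult split: if_splits)

end

section \<open>Polynomials ordered by their initial monomials\<close>

text \<open>
  Gauss valuations and their relatives give a polynomial the smallest value of its monomials. It
  suffices to say how monomials compare: the pair \<open>(a, i)\<close> stands for the monomial \<open>a y^i\<close>. Two
  nonzero monomials of different degree may have equal value, as happens for the Gauss valuation
  itself.
\<close>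

locale monomial_order =
  fixes M :: "'k::field \<times> nat \<Rightarrow> 'k \<times> nat \<Rightarrow> bool" (infix "\<sqsubseteq>" 50)
  assumes mon_total: "m \<sqsubseteq> m' \<or> m' \<sqsubseteq> m"
    and mon_trans: "m \<sqsubseteq> m' \<Longrightarrow> m' \<sqsubseteq> m'' \<Longrightarrow> m \<sqsubseteq> m''"
    and mon_zero: "m \<sqsubseteq> (0, j)"
    and zero_mon: "(0, i) \<sqsubseteq> (b, j) \<Longrightarrow> b = 0"
    and mon_mult_cancel: "c \<noteq> 0 \<Longrightarrow> (a * c, i + k) \<sqsubseteq> (b * c, j + k) \<longleftrightarrow> (a, i) \<sqsubseteq> (b, j)"
    and mon_add: "m \<sqsubseteq> (a, i) \<Longrightarrow> m \<sqsubseteq> (b, i) \<Longrightarrow> m \<sqsubseteq> (a + b, i)"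

text \<open>
  Some monomial of \<open>f\<close> bounds all monomials of \<open>g\<close> from below, which says that the minimum over
  the monomials of \<open>f\<close> is at most the minimum over those of \<open>g\<close>. The form chosen here does not
  mention degrees and also covers the zero polynomial.
\<close>

definition poly_le :: "('k::field \<times> nat \<Rightarrow> 'k \<times> nat \<Rightarrow> bool) \<Rightarrow> 'k poly \<Rightarrow> 'k poly \<Rightarrow> bool" where
  "poly_le M f g \<longleftrightarrow> (\<exists>i. \<forall>j. M (coeff f i, i) (coeff g j, j))"

context monomial_order
begin

lemma mon_refl: "m \<sqsubseteq> m"
  using mon_total by blast

definition minimal_monomial :: "'k poly \<Rightarrow> nat \<Rightarrow> bool" where
  "minimal_monomial f i \<longleftrightarrow> (\<forall>j. (coeff f i, i) \<sqsubseteq> (coeff f j, j))"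

text \<open>
  Among the monomials of smallest value the one of lowest degree is singled out: products of two
  such monomials cannot be cancelled by other products.
\<close>

definition initial_monomial :: "'k poly \<Rightarrow> nat \<Rightarrow> bool" where
  "initial_monomial f i \<longleftrightarrow>
    minimal_monomial f i \<and> (\<forall>j<i. \<not> (coeff f j, j) \<sqsubseteq> (coeff f i, i))"

lemma initial_monomial_exists: "\<exists>i. initial_monomial f i"
proof -
  have "\<exists>i. \<forall>j\<le>n. (coeff f i, i) \<sqsubseteq> (coeff f j, j)" for n
  proof (induction n)
    case 0
    show ?case using mon_refl by auto
  next
    case (Suc n)
    then obtain i where i: "\<forall>j\<le>n. (coeff f i, i) \<sqsubseteq> (coeff f j, j)" by blast
    show ?case
    proof (cases "(coeff f i, i) \<sqsubseteq> (coeff f (Suc n), Suc n)")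
      case True
      then show ?thesis using i by (intro exI[of _ i]) (auto simp: le_Suc_eq)
    next
      case False
      then have "(coeff f (Suc n), Suc n) \<sqsubseteq> (coeff f i, i)" using mon_total by blast
      then show ?thesis using i mon_trans mon_refl
        by (intro exI[of _ "Suc n"]) (auto simp: le_Suc_eq)
    qed
  qed
  then obtain i where i: "\<forall>j\<le>degree f. (coeff f i, i) \<sqsubseteq> (coeff f j, j)" by blast
  have "(coeff f i, i) \<sqsubseteq> (coeff f j, j)" for j
    using i mon_zero coeff_eq_0[of f j] by (cases "j \<le> degree f") auto
  then have ex: "\<exists>i. minimal_monomial f i" unfolding minimal_monomial_def by blast
  define l where "l = (LEAST i. minimal_monomial f i)"
  have l: "minimal_monomial f l" unfolding l_def using ex by (rule LeastI_ex)
  have "\<not> (coeff f j, j) \<sqsubseteq> (coeff f l, l)" if "j < l" for j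
  proof
    assume "(coeff f j, j) \<sqsubseteq> (coeff f l, l)"
    then have "minimal_monomial f j"
      using l mon_trans unfolding minimal_monomial_def by blast
    then show False using not_less_Least that unfolding l_def by blast
  qed
  with l show ?thesis unfolding initial_monomial_def by blast
qed

lemma minimal_monomial_nonzero:
  "minimal_monomial f i \<Longrightarrow> f \<noteq> 0 \<Longrightarrow> coeff f i \<noteq> 0"
  unfolding minimal_monomial_def by (metis zero_mon coeff_0 poly_eqI)

lemma poly_le_iff_minimal:
  assumes "minimal_monomial f i"
  shows "poly_le M f g \<longleftrightarrow> (\<forall>j. (coeff f i, i) \<sqsubseteq> (coeff g j, j))"
  using assms mon_trans unfolding poly_le_def minimal_monomial_def by blast

lemma poly_le_iff:
  assumes "minimal_monomial f i" "minimal_monomial g j"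
  shows "poly_le M f g \<longleftrightarrow> (coeff f i, i) \<sqsubseteq> (coeff g j, j)"
  using assms mon_trans unfolding poly_le_def minimal_monomial_def by blast

lemma mon_sum:
  assumes "\<And>k. k \<in> S \<Longrightarrow> m \<sqsubseteq> (a k, n)"
  shows "m \<sqsubseteq> (sum a S, n)"
  using assms by (induction S rule: infinite_finite_induct) (auto simp: mon_zero mon_add)

lemma mon_mult_left_mono: "(a, i) \<sqsubseteq> (b, j) \<Longrightarrow> (a * c, i + k) \<sqsubseteq> (b * c, j + k)"
  using mon_mult_cancel mon_zero by (cases "c = 0") auto

lemma mon_mult_mono:
  assumes "(a, i) \<sqsubseteq> (b, j)" "(c, k) \<sqsubseteq> (d, l)"
  shows "(a * c, i + k) \<sqsubseteq> (b * d, j + l)"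
proof (rule mon_trans)
  show "(a * c, i + k) \<sqsubseteq> (b * c, j + k)" using assms(1) by (rule mon_mult_left_mono)
  show "(b * c, j + k) \<sqsubseteq> (b * d, j + l)"
    using mon_mult_left_mono[OF assms(2), of b j] by (simp add: mult.commute add.commute)
qed

lemma mon_less_add:
  assumes "\<not> (a, n) \<sqsubseteq> m" "\<not> (b, n) \<sqsubseteq> m"
  shows "\<not> (a + b, n) \<sqsubseteq> m"
  using assms mon_total[of "(a, n)" "(b, n)"] mon_add[of _ a n b] mon_refl mon_trans by blast

lemma mon_less_sum:
  assumes "finite S" "\<And>k. k \<in> S \<Longrightarrow> \<not> (a k, n) \<sqsubseteq> (c, l)" "c \<noteq> 0"
  shows "\<not> (sum a S, n) \<sqsubseteq> (c, l)"
  using assms by (induction S rule: finite_induct) (auto simp: mon_less_add dest: zero_mon)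

lemma mon_uminus: "(a, n) \<sqsubseteq> (- a, n)"
proof -
  have "(1, 0) \<sqsubseteq> (- 1, 0)"
    using mon_total[of "(1, 0)" "(- 1, 0)"] mon_mult_left_mono[of "- 1" 0 1 0 "- 1" 0] by auto
  from mon_mult_left_mono[OF this, of a n] show ?thesis by simp
qed

text \<open>
  A summand of strictly larger value does not change the value of a sum.
\<close>

lemma mon_add_absorb:
  assumes "\<not> (b, n) \<sqsubseteq> (a, n)"
  shows "(a + b, n) \<sqsubseteq> (a, n)" "(a, n) \<sqsubseteq> (a + b, n)"
proof -
  have "\<not> (- b, n) \<sqsubseteq> (a, n)"
    using assms mon_uminus[of b n] mon_trans by blast
  then show "(a + b, n) \<sqsubseteq> (a, n)"
    using mon_less_add[of "a + b" n "(a, n)" "- b"] mon_refl by auto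
  show "(a, n) \<sqsubseteq> (a + b, n)"
    using assms mon_total mon_add mon_refl by blast
qed

text \<open>
  Gauss's lemma. In the coefficient of \<open>f * g\<close> at \<open>i + j\<close>, every product of coefficients other than the
  one at \<open>(i, j)\<close> involves a coefficient of \<open>f\<close> below \<open>i\<close> or a coefficient of \<open>g\<close> below \<open>j\<close>, hence has
  strictly larger value. So this coefficient has the value of the product of the initial
  monomials, and no monomial of \<open>f * g\<close> has smaller value.
\<close>

lemma minimal_monomial_mult:
  assumes f: "initial_monomial f i" "f \<noteq> 0" and g: "initial_monomial g j" "g \<noteq> 0"
  shows "minimal_monomial (f * g) (i + j)"
    and "(coeff (f * g) (i + j), i + j) \<sqsubseteq> (coeff f i * coeff g j, i + j)"
    and "(coeff f i * coeff g j, i + j) \<sqsubseteq> (coeff (f * g) (i + j), i + j)"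
proof -
  let ?a = "coeff f i * coeff g j"
  have fi: "minimal_monomial f i" and gj: "minimal_monomial g j"
    using f g by (auto simp: initial_monomial_def)
  have nz: "coeff f i \<noteq> 0" "coeff g j \<noteq> 0"
    using minimal_monomial_nonzero fi gj f g by blast+
  have term_ge: "(?a, i + j) \<sqsubseteq> (coeff f k * coeff g l, k + l)" for k l
    using fi gj mon_mult_mono unfolding minimal_monomial_def by blast
  have term_greater: "\<not> (coeff f k * coeff g l, k + l) \<sqsubseteq> (?a, i + j)" if "k < i \<or> l < j" for k l
  proof
    assume *: "(coeff f k * coeff g l, k + l) \<sqsubseteq> (?a, i + j)"
    show False
      using that
    proof
      assume "k < i"
      have "(coeff f k * coeff g j, k + j) \<sqsubseteq> (coeff f k * coeff g l, k + l)"
        using gj mon_mult_mono mon_refl unfolding minimal_monomial_def by blast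
      then have "(coeff f k, k) \<sqsubseteq> (coeff f i, i)"
        using * mon_trans mon_mult_cancel[OF nz(2)] by blast
      then show False using f(1) \<open>k < i\<close> by (auto simp: initial_monomial_def)
    next
      assume "l < j"
      have "(coeff f i * coeff g l, i + l) \<sqsubseteq> (coeff f k * coeff g l, k + l)"
        using fi mon_mult_mono mon_refl unfolding minimal_monomial_def by blast
      then have "(coeff f i * coeff g l, i + l) \<sqsubseteq> (?a, i + j)"
        using * mon_trans by blast
      then have "(coeff g l, l) \<sqsubseteq> (coeff g j, j)"
        using mon_mult_cancel[OF nz(1), of "coeff g l" l i "coeff g j" j] by (simp add: ac_simps)
      then show False using g(1) \<open>l < j\<close> by (auto simp: initial_monomial_def)
    qed
  qed
  have ge: "(?a, i + j) \<sqsubseteq> (coeff (f * g) n, n)" for n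
    unfolding coeff_mult
  proof (rule mon_sum)
    fix k assume "k \<in> {..n}"
    then show "(?a, i + j) \<sqsubseteq> (coeff f k * coeff g (n - k), n)"
      using term_ge[of k "n - k"] by simp
  qed
  show "(?a, i + j) \<sqsubseteq> (coeff (f * g) (i + j), i + j)" by (rule ge)
  let ?r = "\<Sum>k\<in>{..i + j} - {i}. coeff f k * coeff g (i + j - k)"
  have split: "coeff (f * g) (i + j) = ?a + ?r"
    unfolding coeff_mult by (subst sum.remove[of _ i]) auto
  have "\<not> (?r, i + j) \<sqsubseteq> (?a, i + j)"
  proof (rule mon_less_sum)
    fix k assume "k \<in> {..i + j} - {i}"
    then have "k + (i + j - k) = i + j" "k < i \<or> i + j - k < j" by auto
    then show "\<not> (coeff f k * coeff g (i + j - k), i + j) \<sqsubseteq> (?a, i + j)"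
      using term_greater by metis
  qed (use nz in auto)
  then show le: "(coeff (f * g) (i + j), i + j) \<sqsubseteq> (?a, i + j)"
    unfolding split by (rule mon_add_absorb)
  show "minimal_monomial (f * g) (i + j)"
    unfolding minimal_monomial_def using le ge mon_trans by blast
qed

lemma poly_le_zero: "poly_le M f 0"
  unfolding poly_le_def using mon_zero by auto

lemma zero_poly_le_iff: "poly_le M 0 f \<longleftrightarrow> f = 0"
proof
  show "f = 0" if "poly_le M 0 f"
  proof (rule poly_eqI)
    fix n
    show "coeff f n = coeff 0 n"
      using that zero_mon[of _ "coeff f n" n] unfolding poly_le_def by auto
  qed
qed (simp add: poly_le_zero)

text \<open>
  Only cancellation is not immediate: multiplication by \<open>h\<close> multiplies the minimal monomials of \<open>f\<close> and \<open>g\<close>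
  by the same monomial, by Gauss's lemma.
\<close>

lemma valuation_preorder_poly_le: "valuation_preorder (poly_le M)"
proof
  fix f g h :: "'k poly"
  obtain i j k where ijk: "initial_monomial f i" "initial_monomial g j" "initial_monomial h k"
    using initial_monomial_exists by meson
  then have min: "minimal_monomial f i" "minimal_monomial g j" "minimal_monomial h k"
    by (auto simp: initial_monomial_def)
  show "poly_le M f g \<or> poly_le M g f"
    using poly_le_iff min mon_total by blast
  show "poly_le M f h" if "poly_le M f g" "poly_le M g h"
    using that poly_le_iff min mon_trans by blast
  show "poly_le M f 0" by (rule poly_le_zero)
  show "f = 0" if "poly_le M 0 f" using that by (simp add: zero_poly_le_iff)
  show "poly_le M (f * h) (g * h) \<longleftrightarrow> poly_le M f g" if "h \<noteq> 0"
  proof (cases "f = 0 \<or> g = 0")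
    case True
    then show ?thesis using that by (auto simp: poly_le_zero zero_poly_le_iff)
  next
    case False
    note fh = minimal_monomial_mult[OF ijk(1) _ ijk(3) that]
      and gh = minimal_monomial_mult[OF ijk(2) _ ijk(3) that]
    have hk: "coeff h k \<noteq> 0" using minimal_monomial_nonzero min that by blast
    have "poly_le M (f * h) (g * h) \<longleftrightarrow>
        (coeff (f * h) (i + k), i + k) \<sqsubseteq> (coeff (g * h) (j + k), j + k)"
      using fh(1) gh(1) False by (intro poly_le_iff) auto
    also have "\<dots> \<longleftrightarrow> (coeff f i * coeff h k, i + k) \<sqsubseteq> (coeff g j * coeff h k, j + k)"
      using fh(2,3) gh(2,3) False mon_trans by blast
    also have "\<dots> \<longleftrightarrow> poly_le M f g"
      using mon_mult_cancel[OF hk] poly_le_iff min by blast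
    finally show ?thesis .
  qed
  show "poly_le M h (f + g)" if "poly_le M h f" "poly_le M h g"
  proof -
    show ?thesis
      using that unfolding poly_le_iff_minimal[OF min(3)] by (simp add: mon_add)
  qed
qed

lemma poly_le_const: "poly_le M [:a:] [:b:] \<longleftrightarrow> (a, 0) \<sqsubseteq> (b, 0)"
proof -
  have "minimal_monomial [:c:] 0" for c
    unfolding minimal_monomial_def by (auto simp: coeff_pCons mon_zero mon_refl split: nat.split)
  from poly_le_iff[OF this this] show ?thesis by simp
qed

lemma const_poly_le_linear:
  assumes "r \<noteq> 0"
  shows "poly_le M [:s:] [:u, r:] \<longleftrightarrow> (s, 0) \<sqsubseteq> (u, 0) \<and> (s, 0) \<sqsubseteq> (r, 1)"
proof
  assume "poly_le M [:s:] [:u, r:]"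
  then obtain i where i: "\<And>j. (coeff [:s:] i, i) \<sqsubseteq> (coeff [:u, r:] j, j)"
    unfolding poly_le_def by blast
  have "i = 0"
    using i[of 1] assms zero_mon[of i r 1] by (cases i) auto
  then show "(s, 0) \<sqsubseteq> (u, 0) \<and> (s, 0) \<sqsubseteq> (r, 1)"
    using i[of 0] i[of 1] by simp
next
  assume "(s, 0) \<sqsubseteq> (u, 0) \<and> (s, 0) \<sqsubseteq> (r, 1)"
  then show "poly_le M [:s:] [:u, r:]"
    unfolding poly_le_def
    by (intro exI[of _ 0]) (auto simp: coeff_pCons mon_zero split: nat.split)
qed

lemma linear_poly_le_const:
  assumes "s \<noteq> 0"
  shows "poly_le M [:u, r:] [:s:] \<longleftrightarrow> (u, 0) \<sqsubseteq> (s, 0) \<or> (r, 1) \<sqsubseteq> (s, 0)"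
proof -
  have "poly_le M [:u, r:] [:s:] \<longleftrightarrow> (\<exists>i. (coeff [:u, r:] i, i) \<sqsubseteq> (s, 0))"
    unfolding poly_le_def by (auto simp: coeff_pCons mon_zero split: nat.splits)
  also have "\<dots> \<longleftrightarrow> (u, 0) \<sqsubseteq> (s, 0) \<or> (r, 1) \<sqsubseteq> (s, 0)" (is "?l \<longleftrightarrow> ?r")
  proof
    assume ?l
    then obtain i where i: "(coeff [:u, r:] i, i) \<sqsubseteq> (s, 0)" by blast
    then have "i < 2" using assms zero_mon[of i s 0]
      by (cases "i < 2") (auto simp: coeff_eq_0 le_less_trans[OF degree_pCons_le])
    then show ?r using i by (auto simp: less_2_cases_iff)
  next
    assume ?r
    then show ?l by (metis coeff_pCons_0 coeff_pCons_Suc One_nat_def)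
  qed
  finally show ?thesis .
qed

end


section \<open>The valuations of balls\<close>

text \<open>
  The three orders give the variable \<open>y\<close> the value zero, a positive value smaller than every positive
  value of \<open>K\<close>, and a value smaller than all values of \<open>K\<close>, respectively. The second is the
  lexicographic order in which the degree breaks ties between values, the third the lexicographic
  order in which larger degree decides first. Zero coefficients need care in the lexicographic
  orders because a zero monomial has infinite value in every degree.
\<close>

definition gauss_mon where
  "gauss_mon R = (\<lambda>(a, i) (b, j). R a b)"

definition infinitesimal_mon where
  "infinitesimal_mon R = (\<lambda>(a, i::nat) (b, j). b = 0 \<or> R a b \<and> (R b a \<longrightarrow> i \<le> j))"

definition degree_mon where
  "degree_mon R = (\<lambda>(a, i::nat) (b, j). b = 0 \<or> a \<noteq> 0 \<and> (j < i \<or> j = i \<and> R a b))"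

context field_valuation_preorder
begin

lemma monomial_order_gauss_mon: "monomial_order (gauss_mon R)"
proof
  show "gauss_mon R m m' \<or> gauss_mon R m' m" for m m'
    using le_total by (auto simp: gauss_mon_def split: prod.split)
  show "gauss_mon R m m''" if "gauss_mon R m m'" "gauss_mon R m' m''" for m m' m''
    using that by (auto simp: gauss_mon_def split: prod.splits intro: le_trans)
  show "b = 0" if "gauss_mon R (0, i) (b, j)" for b i j
    using that zero_le by (auto simp: gauss_mon_def)
qed (auto simp: gauss_mon_def le_zero le_mult_cancel le_add)

lemma monomial_order_infinitesimal_mon: "monomial_order (infinitesimal_mon R)"
proof
  show "infinitesimal_mon R m m' \<or> infinitesimal_mon R m' m" for m m'
    using le_total by (cases m; cases m') (auto simp: infinitesimal_mon_def)
  show "infinitesimal_mon R m m''"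
    if "infinitesimal_mon R m m'" "infinitesimal_mon R m' m''" for m m' m''
  proof -
    obtain a i b j c k where m: "m = (a, i)" "m' = (b, j)" "m'' = (c, k)"
      by (metis surj_pair)
    show ?thesis
    proof (cases "b = 0 \<or> c = 0")
      case True
      then show ?thesis using that zero_le by (auto simp: infinitesimal_mon_def m)
    next
      case False
      then have "R a b" "R b c" "R b a \<Longrightarrow> i \<le> j" "R c b \<Longrightarrow> j \<le> k"
        using that by (auto simp: infinitesimal_mon_def m)
      moreover from this have "R a c" "R c a \<Longrightarrow> R b a" "R c a \<Longrightarrow> R c b"
        by (blast intro: le_trans)+
      ultimately show ?thesis by (auto simp: infinitesimal_mon_def m)
    qed
  qed
  show "b = 0" if "infinitesimal_mon R (0, i) (b, j)" for b i j
    using that zero_le by (auto simp: infinitesimal_mon_def)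
  show "infinitesimal_mon R m (a + b, i)"
    if "infinitesimal_mon R m (a, i)" "infinitesimal_mon R m (b, i)" for m a b i
    using that le_add less_add by (cases m) (auto simp: infinitesimal_mon_def)
qed (auto simp: infinitesimal_mon_def le_mult_cancel split: prod.split)

lemma monomial_order_degree_mon: "monomial_order (degree_mon R)"
proof
  show "degree_mon R m m' \<or> degree_mon R m' m" for m m'
    using le_total by (cases m; cases m') (auto simp: degree_mon_def)
  show "degree_mon R m m''" if "degree_mon R m m'" "degree_mon R m' m''" for m m' m''
    using that by (cases m; cases m'; cases m'') (auto simp: degree_mon_def intro: le_trans)
  show "degree_mon R m (a + b, i)"
    if "degree_mon R m (a, i)" "degree_mon R m (b, i)" for m a b i
    using that le_add by (cases m) (auto simp: degree_mon_def)
qed (auto simp: degree_mon_def le_mult_cancel split: prod.split)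

end

text \<open>
  The substitution \<open>x = c + r y\<close> moves the ball around \<open>c\<close> with radius \<open>v r\<close> to the ball around \<open>0\<close>
  with radius zero. Radii are represented by nonzero field elements \<open>r\<close>, so no calculation in the
  value group occurs.
\<close>

definition ball_order ::
    "('k::field \<Rightarrow> 'k \<Rightarrow> bool) \<Rightarrow> bool \<times> 'k \<times> 'k \<Rightarrow> 'k poly \<Rightarrow> 'k poly \<Rightarrow> bool" where
  "ball_order R = (\<lambda>(open_kind, c, r) f g.
     poly_le (if open_kind then infinitesimal_mon R else gauss_mon R)
       (f \<circ>\<^sub>p [:c, r:]) (g \<circ>\<^sub>p [:c, r:]))"

lemma valuation_preorder_pcompose:
  fixes D :: "'k::field poly \<Rightarrow> 'k poly \<Rightarrow> bool"
  assumes "valuation_preorder D" "degree p > 0"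
  shows "valuation_preorder (\<lambda>f g. D (f \<circ>\<^sub>p p) (g \<circ>\<^sub>p p))"
proof -
  interpret D: valuation_preorder D by (rule assms)
  have nz: "f \<circ>\<^sub>p p = 0 \<longleftrightarrow> f = 0" for f
    using pcompose_eq_0_iff[of p f] assms(2) by auto
  show ?thesis
  proof
    show "f = 0" if "D (0 \<circ>\<^sub>p p) (f \<circ>\<^sub>p p)" for f
      using D.zero_le[of "f \<circ>\<^sub>p p"] that nz by simp
  qed (auto simp: pcompose_add pcompose_mult nz D.le_total D.le_zero D.le_mult_cancel D.le_add
      intro: D.le_trans)
qed

context field_valuation_preorder
begin

lemma monomial_order_kind:
  "monomial_order (if k then infinitesimal_mon R else gauss_mon R)"
  using monomial_order_gauss_mon monomial_order_infinitesimal_mon by simp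

lemma valuation_preorder_ball_order:
  assumes "r \<noteq> 0"
  shows "valuation_preorder (ball_order R (k, c, r))"
  unfolding ball_order_def prod.case
  by (rule valuation_preorder_pcompose[OF
      monomial_order.valuation_preorder_poly_le[OF monomial_order_kind]])
    (use assms in simp)

lemma ball_order_const: "ball_order R (k, c, r) [:a:] [:b:] \<longleftrightarrow> a \<preceq> b"
  using le_zero
  by (auto simp: ball_order_def monomial_order.poly_le_const[OF monomial_order_kind]
      gauss_mon_def infinitesimal_mon_def)

lemma linear_pcompose: "[:- d, 1::'a:] \<circ>\<^sub>p [:c, r:] = [:c - d, r:]"
  by (simp add: pcompose_pCons)

text \<open>
  In the variable \<open>y\<close> the polynomial \<open>x - d\<close> is \<open>(c - d) + r y\<close>, whose value is the minimum of \<open>v (c - d)\<close>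
  and the value of \<open>r y\<close>. The latter is \<open>v r\<close> for the closed ball and infinitesimally larger for the
  open ball. A comparison from below with \<open>v s\<close> does not see this difference, the comparison from
  above in \<open>linear_ball_order_const\<close> does.
\<close>

lemma const_ball_order_linear:
  assumes "r \<noteq> 0"
  shows "ball_order R (k, c, r) [:s:] [:- d, 1:] \<longleftrightarrow> s \<preceq> c - d \<and> s \<preceq> r"
  using assms le_zero[of s]
  by (auto simp: ball_order_def linear_pcompose gauss_mon_def infinitesimal_mon_def
      monomial_order.const_poly_le_linear[OF monomial_order_kind])

lemma linear_ball_order_const:
  assumes "s \<noteq> 0"
  shows "ball_order R (k, c, r) [:- d, 1:] [:s:] \<longleftrightarrow>
    c - d \<preceq> s \<or> (if k then \<not> s \<preceq> r else r \<preceq> s)"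
  using assms le_total[of r s]
  by (auto simp: ball_order_def linear_pcompose gauss_mon_def infinitesimal_mon_def
      monomial_order.linear_poly_le_const[OF monomial_order_kind])

end

section \<open>Limits along ultrafilters\<close>

definition ultrafilter :: "'i filter \<Rightarrow> bool" where
  "ultrafilter U \<longleftrightarrow> U \<noteq> bot \<and> (\<forall>P. eventually P U \<or> eventually (\<lambda>i. \<not> P i) U)"

lemma ultrafilter_not_eventually:
  assumes "ultrafilter U"
  shows "\<not> eventually P U \<longleftrightarrow> eventually (\<lambda>i. \<not> P i) U"
proof -
  have False if "eventually P U" "eventually (\<lambda>i. \<not> P i) U"
    using eventually_conj[OF that] assms by (simp add: ultrafilter_def)
  then show ?thesis using assms unfolding ultrafilter_def by blast
qed

text \<open>
  By Zorn's lemma there is a minimal proper filter below \<open>F\<close>. If it does not contain the complement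
  of \<open>P\<close>, then adding \<open>P\<close> to it leaves it proper and hence unchanged.
\<close>

lemma ultrafilter_exists:
  fixes F :: "'i filter"
  assumes "F \<noteq> bot"
  shows "\<exists>U\<le>F. ultrafilter U"
proof -
  let ?\<A> = "{U. U \<le> F \<and> U \<noteq> bot}"
  let ?r = "{(U, W). U \<in> ?\<A> \<and> W \<in> ?\<A> \<and> W \<le> U}"
  have field: "Field ?r = ?\<A>" by (auto simp: Field_def)
  have "\<exists>U\<in>Field ?r. \<forall>W\<in>Field ?r. (U, W) \<in> ?r \<longrightarrow> W = U"
  proof (rule Zorns_po_lemma)
    show "Partial_order ?r"
      unfolding order_on_defs field
      by (auto simp: refl_on_def trans_def antisym_def intro: order_trans)
    fix C assume C: "C \<in> Chains ?r"
    then have sub: "C \<subseteq> ?\<A>" by (auto simp: Chains_def)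
    show "\<exists>u\<in>Field ?r. \<forall>a\<in>C. (a, u) \<in> ?r"
    proof (cases "C = {}")
      case True
      then show ?thesis using assms unfolding field by blast
    next
      case False
      have "\<exists>x\<in>C. x \<le> inf U W" if "U \<in> C" "W \<in> C" for U W
        using C that by (auto simp: Chains_def)
      then have "Inf C \<noteq> bot"
        using eventually_Inf_base[OF False, of "\<lambda>_. False"] sub
        by (auto simp: trivial_limit_def)
      moreover have "Inf C \<le> F" using False sub by (blast intro: Inf_lower2)
      ultimately show ?thesis
        using sub unfolding field by (intro bexI[of _ "Inf C"]) (auto intro: Inf_lower)
    qed
  qed
  then obtain U where U: "U \<le> F" "U \<noteq> bot"
    and min: "\<And>W. W \<le> U \<Longrightarrow> W \<noteq> bot \<Longrightarrow> W = U"
    unfolding field by (auto intro: order_trans)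
  have "eventually P U \<or> eventually (\<lambda>i. \<not> P i) U" for P
  proof (cases "inf U (principal {i. P i}) = bot")
    case True
    then show ?thesis by (simp add: trivial_limit_def eventually_inf_principal)
  next
    case False
    then have "inf U (principal {i. P i}) = U" by (intro min) auto
    then have "U \<le> principal {i. P i}" by (simp add: inf.absorb_iff1)
    then show ?thesis by (simp add: le_principal)
  qed
  then show ?thesis using U unfolding ultrafilter_def by blast
qed

text \<open>
  Totality is the only axiom with a disjunction, and the only one for which a filter would not be
  enough.
\<close>

lemma valuation_preorder_ultralimit:
  assumes U: "ultrafilter U" and pre: "\<forall>\<^sub>F i in U. valuation_preorder (D i)"
  shows "valuation_preorder (\<lambda>a b. \<forall>\<^sub>F i in U. D i a b)"
proof
  have nb: "U \<noteq> bot" using U by (simp add: ultrafilter_def)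
  show "(\<forall>\<^sub>F i in U. D i a b) \<or> (\<forall>\<^sub>F i in U. D i b a)" for a b
  proof (rule disjCI)
    assume "\<not> (\<forall>\<^sub>F i in U. D i b a)"
    then have "\<forall>\<^sub>F i in U. \<not> D i b a" using ultrafilter_not_eventually[OF U] by blast
    with pre show "\<forall>\<^sub>F i in U. D i a b"
      by eventually_elim (use valuation_preorder.le_total in blast)
  qed
  show "\<forall>\<^sub>F i in U. D i a c" if "\<forall>\<^sub>F i in U. D i a b" "\<forall>\<^sub>F i in U. D i b c" for a b c
    using pre that by eventually_elim (rule valuation_preorder.le_trans)
  show "\<forall>\<^sub>F i in U. D i a 0" for a
    using pre by eventually_elim (rule valuation_preorder.le_zero)
  show "a = 0" if "\<forall>\<^sub>F i in U. D i 0 a" for a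
  proof -
    have "\<forall>\<^sub>F i in U. a = 0"
      using pre that by eventually_elim (rule valuation_preorder.zero_le)
    then show ?thesis using nb by (simp add: eventually_const)
  qed
  show "(\<forall>\<^sub>F i in U. D i (a * c) (b * c)) \<longleftrightarrow> (\<forall>\<^sub>F i in U. D i a b)" if "c \<noteq> 0" for a b c
    by (rule eventually_subst, use pre in eventually_elim)
      (rule valuation_preorder.le_mult_cancel[OF _ that])
  show "\<forall>\<^sub>F i in U. D i c (a + b)" if "\<forall>\<^sub>F i in U. D i c a" "\<forall>\<^sub>F i in U. D i c b" for a b c
    using pre that by eventually_elim (rule valuation_preorder.le_add)
qed

section \<open>Extending a valuation preorder to the field of fractions\<close>

definition fract_le :: "('a::idom \<Rightarrow> 'a \<Rightarrow> bool) \<Rightarrow> 'a fract \<Rightarrow> 'a fract \<Rightarrow> bool" where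
  "fract_le D z w \<longleftrightarrow> (\<exists>f g h. h \<noteq> 0 \<and> z = Fract f h \<and> w = Fract g h \<and> D f g)"

text \<open>
  Three fractions suffice, as no axiom of a valuation preorder involves more than three elements.
\<close>

lemma common_denominator:
  obtains a b c d where "d \<noteq> 0" "z = Fract a d" "w = Fract b d" "u = Fract c d"
proof -
  obtain a a' b b' c c' where z: "z = Fract a a'" "a' \<noteq> 0"
    and w: "w = Fract b b'" "b' \<noteq> 0" and u: "u = Fract c c'" "c' \<noteq> 0"
    by (metis Fract_cases)
  then show ?thesis
    by (intro that[of "a' * b' * c'" "a * b' * c'" "b * a' * c'" "c * a' * b'"])
      (auto simp: eq_fract)
qed

context valuation_preorder
begin

lemma fract_le_Fract:
  assumes "h \<noteq> 0"
  shows "fract_le R (Fract f h) (Fract g h) \<longleftrightarrow> f \<preceq> g"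
proof
  assume "fract_le R (Fract f h) (Fract g h)"
  then obtain f' g' h' where h': "h' \<noteq> 0" "Fract f h = Fract f' h'" "Fract g h = Fract g' h'"
    and le: "f' \<preceq> g'"
    unfolding fract_le_def by blast
  then have "f * h' = f' * h" "g * h' = g' * h" using assms by (auto simp: eq_fract)
  then show "f \<preceq> g" using le le_mult_cancel h'(1) assms by metis
qed (use assms in \<open>auto simp: fract_le_def\<close>)

lemma valuation_preorder_fract_le: "valuation_preorder (fract_le R)"
proof
  fix z w u :: "'a fract"
  obtain a b c d where d: "d \<noteq> 0" "z = Fract a d" "w = Fract b d" "u = Fract c d"
    by (rule common_denominator)
  have zero: "0 = Fract 0 d" using d(1) by (simp add: Zero_fract_def eq_fract)
  show "fract_le R z w \<or> fract_le R w z"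
    using le_total d by (auto simp: fract_le_Fract)
  show "fract_le R z u" if "fract_le R z w" "fract_le R w u"
    using that d by (auto simp: fract_le_Fract intro: le_trans)
  show "fract_le R z 0"
    using d by (simp add: zero fract_le_Fract le_zero)
  show "z = 0" if "fract_le R 0 z"
    using that zero_le d by (auto simp: zero fract_le_Fract)
  show "fract_le R (z * u) (w * u) \<longleftrightarrow> fract_le R z w" if "u \<noteq> 0"
  proof -
    have "c \<noteq> 0" using that d zero by auto
    then show ?thesis using d by (simp add: fract_le_Fract le_mult_cancel)
  qed
  show "fract_le R u (z + w)" if "fract_le R u z" "fract_le R u w"
  proof -
    have "z + w = Fract (a + b) d" using d by (simp add: eq_fract algebra_simps)
    then show ?thesis using that d by (simp add: fract_le_Fract le_add)
  qed
qed

lemma fract_le_to_fract: "fract_le R (to_fract f) (to_fract g) \<longleftrightarrow> f \<preceq> g"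
  using fract_le_Fract[of 1 f g] by (simp add: to_fract_def)

end


section \<open>The order attached to an approximation type\<close>

lemma (in krull_valuation) field_valuation_preorder_val:
  "field_valuation_preorder (\<lambda>a b. vle G (v a) (v b))"
  by (simp add: field_valuation_preorder_def valuation_preorder_val)

text \<open>
  A ball is described by a triple consisting of a flag that marks open balls, a center \<open>c\<close> and a field
  element \<open>r\<close> whose value is the radius.
\<close>

locale nontrivial_approximation = krull_valuation G v
  for G :: "'g ogroup" and v :: "'k::field \<Rightarrow> 'g ext_val" +
  fixes A :: "('g, 'k) ball set"
  assumes approximation: "approximation_type G v A"
    and nontrivial: "\<not> trivial_appr_type A"
begin

abbreviation val_le (infix "\<preceq>" 50) where "a \<preceq> b \<equiv> vle G (v a) (v b)"

sublocale field_valuation_preorder val_le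
  by (rule field_valuation_preorder_val)

text \<open>
  For \<open>r = 0\<close> the triple would describe a ball of radius \<open>\<infinity>\<close>, and a nontrivial approximation type
  has no such member (\<open>radius_nonzero\<close>).
\<close>

definition ball_mem :: "bool \<times> 'k \<times> 'k \<Rightarrow> bool" where
  "ball_mem = (\<lambda>(open_kind, c, r).
    if open_kind then \<exists>\<gamma>. v r = Fin \<gamma> \<and> open_ball G v \<gamma> c \<in> A else closed_ball G v (v r) c \<in> A)"

definition ball_points :: "bool \<times> 'k \<times> 'k \<Rightarrow> 'k set" where
  "ball_points = (\<lambda>(open_kind, c, r).
    if open_kind then {a. \<not> a - c \<preceq> r} else {a. r \<preceq> a - c})"

text \<open>
  The radius of the first ball is at most that of the second, where an open ball counts as having
  an infinitesimally larger radius than the closed ball of the same radius. Along a chain of balls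
  a larger radius means a smaller ball.
\<close>

definition radius_le :: "bool \<times> 'k \<times> 'k \<Rightarrow> bool \<times> 'k \<times> 'k \<Rightarrow> bool" where
  "radius_le = (\<lambda>(open_kind', c', r') (open_kind, c, r).
    if open_kind' \<and> \<not> open_kind then \<not> r \<preceq> r' else r' \<preceq> r)"

lemma mem_ball_points:
  "a \<in> ball_points (k, c, r) \<longleftrightarrow> (if k then \<not> a - c \<preceq> r else r \<preceq> a - c)"
  by (simp add: ball_points_def)

lemma points_closed: "points (closed_ball G v (v r) c) = ball_points (False, c, r)"
  by (simp add: closed_ball_def ball_points_def)

lemma points_open:
  assumes "v r = Fin \<gamma>"
  shows "points (open_ball G v \<gamma> c) = ball_points (True, c, r)"
  by (simp add: open_ball_def ball_points_def assms[symmetric] vless_iff)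

lemma radius_nonzero: "ball_mem (k, c, r) \<Longrightarrow> r \<noteq> 0"
proof
  assume "ball_mem (k, c, r)" "r = 0"
  moreover have "v 0 = Infty" by (simp add: val_infty_iff)
  ultimately have "closed_ball G v Infty c \<in> A"
    by (auto simp: ball_mem_def split: if_splits)
  then show False
    using nontrivial by (auto simp: trivial_appr_type_def supp_def closed_ball_def)
qed

lemma closed_ball_of_open_ball:
  "open_ball G v \<gamma> c \<in> A \<Longrightarrow> \<gamma> \<in> carrier (value_group G v) \<Longrightarrow> closed_ball G v (Fin \<gamma>) c \<in> A"
  using approximation unfolding approximation_type_def by blast

text \<open>
  The two closure axioms of approximation types in one statement: membership in \<open>A\<close> is inherited by
  every ball around the same center whose radius is not larger, be it open or closed.
\<close>

lemma ball_mem_smaller_radius: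
  assumes "ball_mem (k, c, r)" "radius_le (k', c', r') (k, c, r)" "r' \<noteq> 0"
  shows "ball_mem (k', c, r')"
proof -
  obtain \<gamma> where \<gamma>: "v r = Fin \<gamma>"
    using radius_nonzero[OF assms(1)] val_infty_iff[of r] by (cases "v r") auto
  obtain \<gamma>' where \<gamma>': "v r' = Fin \<gamma>'"
    using assms(3) val_infty_iff[of r'] by (cases "v r'") auto
  have rad: "v r \<in> radii G v" by (simp add: radii_eq_range)
  have fin: "\<gamma> \<in> carrier (value_group G v)" "\<gamma>' \<in> carrier (value_group G v)"
    using \<gamma> \<gamma>' by (auto simp: value_group_def)
  have closed: "closed_ball G v (v r) c \<in> A"
    using assms(1) closed_ball_of_open_ball[OF _ fin(1)] \<gamma> by (cases k) (auto simp: ball_mem_def)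
  show ?thesis
  proof (cases "r \<preceq> r'")
    case True
    then have "v r = v r'" "k' \<Longrightarrow> k"
      using assms(2) vle_antisym by (auto simp: radius_le_def split: if_splits)
    then show ?thesis
      using assms(1) closed by (cases k') (auto simp: ball_mem_def)
  next
    case False
    then have "vless G (Fin \<gamma>') (v r)" using \<gamma>' vless_iff[of r' r] by simp
    then have "closed_ball G v (Fin \<gamma>') c \<in> A" "open_ball G v \<gamma>' c \<in> A"
      using closed approximation rad fin unfolding approximation_type_def by blast+
    then show ?thesis using \<gamma>' by (auto simp: ball_mem_def)
  qed
qed

lemma ball_mem_recenter:
  assumes "ball_mem (k, c, r)" "d \<in> ball_points (k, c, r)"
  shows "ball_mem (k, d, r)"
proof (cases k)
  case True
  obtain \<gamma> where \<gamma>: "v r = Fin \<gamma>" "open_ball G v \<gamma> c \<in> A"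
    using assms(1) True by (auto simp: ball_mem_def)
  have "\<not> d - c \<preceq> r" using assms(2) True by (simp add: ball_points_def)
  then have "a - d \<preceq> r \<longleftrightarrow> a - c \<preceq> r" for a
    using diff_le_iff[of "d - c" r "a - c"] by simp
  then have "open_ball G v \<gamma> d = open_ball G v \<gamma> c"
    by (simp add: open_ball_def \<gamma>(1)[symmetric] vless_iff)
  then show ?thesis using \<gamma> True by (simp add: ball_mem_def)
next
  case False
  have "r \<preceq> d - c" using assms(2) False by (simp add: ball_points_def)
  then have "r \<preceq> a - d \<longleftrightarrow> r \<preceq> a - c" for a
    using le_diff_iff[of r "d - c" "a - c"] by simp
  then have "closed_ball G v (v r) d = closed_ball G v (v r) c"
    by (simp add: closed_ball_def)
  then show ?thesis using assms(1) False by (simp add: ball_mem_def)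
qed

lemma center_in_ball: "ball_mem (k, c, r) \<Longrightarrow> c \<in> ball_points (k, c, r)"
  using radius_nonzero[of k c r] le_zero zero_le by (auto simp: ball_points_def)

lemma points_in_A:
  assumes "ball_mem b"
  shows "\<exists>B\<in>A. points B = ball_points b"
proof -
  obtain k c r where b: "b = (k, c, r)" by (metis surj_pair)
  show ?thesis
    using assms points_closed[of r c] points_open[of r _ c] unfolding b
    by (cases k) (auto simp: ball_mem_def intro: bexI[rotated])
qed

lemma ball_points_comparable:
  assumes "ball_mem b" "ball_mem b'"
  shows "ball_points b \<subseteq> ball_points b' \<or> ball_points b' \<subseteq> ball_points b"
  using points_in_A[OF assms(1)] points_in_A[OF assms(2)] approximation
  unfolding approximation_type_def by metis

text \<open>
  Since the two balls are comparable, one of them contains the center of the other. If it is the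
  one with the larger radius, then its condition on \<open>c - c'\<close> is the stronger of the two.
\<close>

lemma center_in_larger_ball:
  assumes "ball_mem (k, c, r)" "ball_mem (k', c', r')" "radius_le (k', c', r') (k, c, r)"
  shows "c \<in> ball_points (k', c', r')"
proof -
  have "c \<in> ball_points (k', c', r') \<or> c' \<in> ball_points (k, c, r)"
    using ball_points_comparable[OF assms(1,2)] center_in_ball assms(1,2) by blast
  then show ?thesis
  proof
    assume "c' \<in> ball_points (k, c, r)"
    then have *: "if k then \<not> c - c' \<preceq> r else r \<preceq> c - c'"
      using minus_swap_le[of c' c r] le_minus_swap[of r c' c] by (auto simp: mem_ball_points)
    have larger: "if k' \<and> \<not> k then \<not> r \<preceq> r' else r' \<preceq> r"
      using assms(3) by (simp add: radius_le_def)
    have "if k' then \<not> c - c' \<preceq> r' else r' \<preceq> c - c'"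
      using * larger le_trans[of "c - c'" r' r] le_trans[of r "c - c'" r']
        le_trans[of r' r "c - c'"] le_total[of r "c - c'"]
      by (cases k; cases k') auto
    then show ?thesis by (simp add: mem_ball_points)
  qed
qed

text \<open>
  The condition which a ball imposes on \<open>x\<close>: for the value described by \<open>D\<close>, the element \<open>x\<close> lies in
  the ball with the same center and radius over \<open>K(x)\<close>.
\<close>

definition realizes :: "('k poly \<Rightarrow> 'k poly \<Rightarrow> bool) \<Rightarrow> bool \<times> 'k \<times> 'k \<Rightarrow> bool" where
  "realizes D = (\<lambda>(open_kind, c, r).
    if open_kind then \<not> D [:- c, 1:] [:r:] else D [:r:] [:- c, 1:])"

lemma realizes_ball_order_iff:
  assumes "r \<noteq> 0" "r' \<noteq> 0"
  shows "realizes (ball_order val_le (k, c, r)) (k', c', r') \<longleftrightarrow>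
    c \<in> ball_points (k', c', r') \<and> radius_le (k', c', r') (k, c, r)"
  using const_ball_order_linear[OF assms(1)] linear_ball_order_const[OF assms(2)]
  by (auto simp: realizes_def ball_points_def radius_le_def)

text \<open>
  The valuation of a member of \<open>A\<close> puts \<open>x\<close> into no ball outside \<open>A\<close>. A ball which contains \<open>x\<close> has
  radius at most that of the member and contains its center, so it arises from the member by
  decreasing the radius and changing the center.
\<close>

lemma realizes_ball_order_imp_mem:
  assumes "ball_mem b" "realizes (ball_order val_le b) (k', c', r')" "r' \<noteq> 0"
  shows "ball_mem (k', c', r')"
proof -
  obtain k c r where b: "b = (k, c, r)" by (metis surj_pair)
  have *: "c \<in> ball_points (k', c', r')" "radius_le (k', c', r') (k, c, r)"
    using assms realizes_ball_order_iff radius_nonzero unfolding b by blast+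
  have "ball_mem (k', c, r')"
    using ball_mem_smaller_radius assms * unfolding b by blast
  moreover have "c' \<in> ball_points (k', c, r')"
    using *(1) minus_swap_le[of c' c r'] le_minus_swap[of r' c' c] by (auto simp: mem_ball_points)
  ultimately show ?thesis by (rule ball_mem_recenter)
qed

lemma radius_le_total: "radius_le b b' \<or> radius_le b' b"
  using le_total by (cases b; cases b') (auto simp: radius_le_def)

lemma radius_le_refl: "radius_le b b"
  using radius_le_total by blast

lemma radius_le_trans:
  assumes "radius_le b b'" "radius_le b' b''"
  shows "radius_le b b''"
proof -
  obtain k c r k' c' r' k'' c'' r'' where b: "b = (k, c, r)" "b' = (k', c', r')" "b'' = (k'', c'', r'')"
    by (metis surj_pair)
  show ?thesis
    using assms le_trans[of r r' r''] le_trans[of r'' r r'] le_trans[of r' r'' r]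
      le_total[of r r'] le_total[of r' r'']
    unfolding b by (cases k; cases k'; cases k'') (auto simp: radius_le_def)
qed

text \<open>
  Compactness: along the chain of members of \<open>A\<close>, ordered by increasing radius, the valuations of
  these members eventually satisfy each condition imposed by \<open>A\<close> and never a condition imposed by
  another ball. Their ultralimit along any ultrafilter that contains all final segments of the chain
  then satisfies exactly the conditions imposed by \<open>A\<close>.
\<close>

lemma exists_realizing_order:
  "\<exists>D. valuation_preorder D \<and> (\<forall>a b. D [:a:] [:b:] \<longleftrightarrow> a \<preceq> b) \<and>
    (\<forall>k c r. r \<noteq> 0 \<longrightarrow> realizes D (k, c, r) \<longleftrightarrow> ball_mem (k, c, r))"
proof (cases "\<exists>b. ball_mem b")
  case False
  \<comment> \<open>If no ball lies in A, then x must have smaller value than all constants.\<close>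
  interpret deg: monomial_order "degree_mon val_le" by (rule monomial_order_degree_mon)
  let ?D = "poly_le (degree_mon val_le)"
  have "?D [:a:] [:b:] \<longleftrightarrow> a \<preceq> b" for a b
  proof -
    have "degree_mon val_le (a, 0) (b, 0) \<longleftrightarrow> a \<preceq> b"
      using le_zero zero_le[of b] by (auto simp: degree_mon_def)
    then show ?thesis by (simp add: deg.poly_le_const)
  qed
  moreover have "\<not> realizes ?D (k, c, r)" if "r \<noteq> 0" for k c r
    using that deg.const_poly_le_linear[of 1 r "- c"] deg.linear_poly_le_const[of r "- c" 1]
    unfolding realizes_def by (auto simp: degree_mon_def[of val_le])
  ultimately show ?thesis
    using deg.valuation_preorder_poly_le False by (intro exI[of _ ?D]) auto
next
  case True
  \<comment> \<open>The sets S b are the final segments of the chain and generate the filter F.\<close>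
  let ?S = "\<lambda>b. {b'. ball_mem b' \<and> radius_le b b'}"
  define F where "F = (INF b\<in>Collect ball_mem. principal (?S b))"
  have ev_F: "eventually P F \<longleftrightarrow> (\<exists>b\<in>Collect ball_mem. eventually P (principal (?S b)))" for P
    unfolding F_def
  proof (rule eventually_INF_base)
    show "Collect ball_mem \<noteq> {}" using True by auto
    fix a b assume ab: "a \<in> Collect ball_mem" "b \<in> Collect ball_mem"
    obtain x where x: "x = a \<or> x = b" "radius_le a x" "radius_le b x"
      using radius_le_total by blast
    then have "?S x \<subseteq> ?S a" "?S x \<subseteq> ?S b"
      using radius_le_trans by blast+
    then show "\<exists>x\<in>Collect ball_mem. principal (?S x) \<le> inf (principal (?S a)) (principal (?S b))"
      using x(1) ab by (intro bexI[of _ x]) auto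
  qed
  have "\<not> eventually (\<lambda>_. False) F"
    unfolding ev_F eventually_principal using radius_le_refl by blast
  then have "F \<noteq> bot" by (simp add: trivial_limit_def)
  then obtain U where U: "U \<le> F" "ultrafilter U" using ultrafilter_exists by blast
  have ev_beyond: "\<forall>\<^sub>F b' in U. ball_mem b' \<and> radius_le b b'" if "ball_mem b" for b
  proof (rule filter_leD[OF U(1)])
    show "\<forall>\<^sub>F b' in F. ball_mem b' \<and> radius_le b b'"
      unfolding ev_F eventually_principal using that by blast
  qed
  obtain b where "ball_mem b" using True by blast
  from ev_beyond[OF this] have ev_mem: "\<forall>\<^sub>F b in U. ball_mem b"
    by (rule eventually_mono) simp
  let ?D = "\<lambda>f g. \<forall>\<^sub>F b in U. ball_order val_le b f g"
  have "valuation_preorder ?D"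
  proof (rule valuation_preorder_ultralimit[OF U(2)])
    show "\<forall>\<^sub>F b in U. valuation_preorder (ball_order val_le b)"
      using ev_mem
    proof eventually_elim
      case (elim b)
      then show ?case
        using radius_nonzero valuation_preorder_ball_order by (cases b) blast
    qed
  qed
  moreover have "?D [:a:] [:b:] \<longleftrightarrow> a \<preceq> b" for a b
  proof -
    have "ball_order val_le i [:a:] [:b:] \<longleftrightarrow> a \<preceq> b" for i
      using ball_order_const by (cases i) auto
    moreover have "U \<noteq> bot" using U(2) by (simp add: ultrafilter_def)
    ultimately show ?thesis by (simp add: eventually_const)
  qed
  moreover have "realizes ?D (k, c, r) \<longleftrightarrow> ball_mem (k, c, r)" if r: "r \<noteq> 0" for k c r
  proof -
    \<comment> \<open>For open balls the condition is negated, and negation commutes with an ultrafilter.\<close>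
    have "realizes ?D (k, c, r) \<longleftrightarrow> (\<forall>\<^sub>F b in U. realizes (ball_order val_le b) (k, c, r))"
      using ultrafilter_not_eventually[OF U(2)] by (simp add: realizes_def)
    also have "\<dots> \<longleftrightarrow> ball_mem (k, c, r)"
    proof
      assume "\<forall>\<^sub>F b in U. realizes (ball_order val_le b) (k, c, r)"
      then have "\<forall>\<^sub>F b in U. ball_mem (k, c, r)"
        using ev_mem by eventually_elim (rule realizes_ball_order_imp_mem[OF _ _ r])
      then show "ball_mem (k, c, r)"
        using U(2) by (auto simp: ultrafilter_def eventually_const)
    next
      assume mem: "ball_mem (k, c, r)"
      show "\<forall>\<^sub>F b in U. realizes (ball_order val_le b) (k, c, r)"
        using ev_beyond[OF mem]
      proof eventually_elim
        case (elim b)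
        obtain k' c' r' where b: "b = (k', c', r')" by (metis surj_pair)
        show ?case
          using elim center_in_larger_ball[OF _ mem] realizes_ball_order_iff[OF radius_nonzero r]
          unfolding b by blast
      qed
    qed
    finally show ?thesis .
  qed
  ultimately show ?thesis by blast
qed

end

section \<open>Extensions and their approximation types\<close>

locale valued_field_extension = krull_valuation G v
  for G :: "'g ogroup" and v :: "'k::field \<Rightarrow> 'g ext_val" +
  fixes \<iota> :: "'k \<Rightarrow> 'l::field" and E :: "('l, 'g, 'h) val_ext"
  assumes extension: "val_extension G v \<iota> E"
begin

abbreviation base_le (infix "\<preceq>" 50) where "a \<preceq> b \<equiv> vle G (v a) (v b)"
abbreviation ext_le (infix "\<preceq>\<^sub>E" 50) where "z \<preceq>\<^sub>E w \<equiv> vle (grp E) (val E z) (val E w)"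

sublocale base: valuation_preorder base_le
  by (rule valuation_preorder_val)

sublocale ext: krull_valuation "grp E" "val E"
  using extension by (simp add: val_extension_def)

sublocale ext: valuation_preorder ext_le
  by (rule ext.valuation_preorder_val)

lemma val_embedding: "val E (\<iota> a) = map_ext_val (emb E) (v a)"
  using extension by (simp add: val_extension_def)

lemma embedding_le_iff: "\<iota> a \<preceq>\<^sub>E \<iota> b \<longleftrightarrow> a \<preceq> b"
proof -
  have "\<forall>\<alpha>\<in>carrier (value_group G v). \<forall>\<beta>\<in>carrier (value_group G v).
      gle G \<alpha> \<beta> \<longleftrightarrow> gle (grp E) (emb E \<alpha>) (emb E \<beta>)"
    using extension by (simp add: val_extension_def ord_embeddings_def value_group_def)
  then show ?thesis
    unfolding val_embedding by (cases "v a"; cases "v b") (auto simp: value_group_def)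
qed

lemma embedding_diff: "\<iota> (a - b) = \<iota> a - \<iota> b"
proof -
  have "\<iota> ((a - b) + b) = \<iota> (a - b) + \<iota> b"
    using extension unfolding val_extension_def field_embedding_def by blast
  then show ?thesis by (simp add: algebra_simps)
qed

text \<open>
  If \<open>x\<close> lies in the ball of given radius around \<open>c\<close>, then it lies in the ball of the same radius around \<open>a\<close>
  iff \<open>a\<close> lies in the one around \<open>c\<close>. This identifies the sets of which \<open>appr\<close> consists as balls.
\<close>

lemma closed_ball_points:
  assumes "\<iota> r \<preceq>\<^sub>E x - \<iota> c"
  shows "r \<preceq> a - c \<longleftrightarrow> \<iota> r \<preceq>\<^sub>E x - \<iota> a"
  using ext.le_diff_iff'[OF assms, of "x - \<iota> a"] embedding_le_iff[of r "a - c"]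
  by (simp add: embedding_diff)

lemma open_ball_points:
  assumes "\<not> x - \<iota> c \<preceq>\<^sub>E \<iota> r"
  shows "a - c \<preceq> r \<longleftrightarrow> x - \<iota> a \<preceq>\<^sub>E \<iota> r"
  using ext.diff_le_iff'[OF assms, of "x - \<iota> a"] embedding_le_iff[of "a - c" r]
  by (simp add: embedding_diff)

lemma closed_ball_in_appr:
  "closed_ball G v (v r) c \<in> appr G v \<iota> E x \<longleftrightarrow> \<iota> r \<preceq>\<^sub>E x - \<iota> c"
proof
  assume "closed_ball G v (v r) c \<in> appr G v \<iota> E x"
  then have "{a. r \<preceq> a - c} = {a. \<iota> r \<preceq>\<^sub>E x - \<iota> a}"
    by (auto simp: closed_ball_def appr_def val_embedding)
  moreover have "r \<preceq> c - c" using base.le_zero by simp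
  ultimately show "\<iota> r \<preceq>\<^sub>E x - \<iota> c" by blast
next
  assume *: "\<iota> r \<preceq>\<^sub>E x - \<iota> c"
  then have "closed_ball G v (v r) c = ClosedBall (v r) {a. \<iota> r \<preceq>\<^sub>E x - \<iota> a}"
    by (simp add: closed_ball_def closed_ball_points)
  with * show "closed_ball G v (v r) c \<in> appr G v \<iota> E x"
    by (auto simp: appr_def radii_eq_range val_embedding[symmetric])
qed

lemma open_ball_in_appr:
  assumes r: "v r = Fin \<gamma>"
  shows "open_ball G v \<gamma> c \<in> appr G v \<iota> E x \<longleftrightarrow> \<not> x - \<iota> c \<preceq>\<^sub>E \<iota> r"
proof -
  have emb: "Fin (emb E \<gamma>) = val E (\<iota> r)" by (simp add: val_embedding r)
  have \<gamma>: "\<gamma> \<in> carrier (value_group G v)" using r by (auto simp: value_group_def)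
  have points: "{a. vless G (Fin \<gamma>) (v (a - c))} = {a. \<not> a - c \<preceq> r}"
    by (simp add: r[symmetric] vless_iff)
  have points': "{a. vless (grp E) (Fin (emb E \<gamma>)) (val E (x - \<iota> a))} = {a. \<not> x - \<iota> a \<preceq>\<^sub>E \<iota> r}"
    by (simp add: emb ext.vless_iff)
  show ?thesis
  proof
    assume "open_ball G v \<gamma> c \<in> appr G v \<iota> E x"
    then have "{a. \<not> a - c \<preceq> r} = {a. \<not> x - \<iota> a \<preceq>\<^sub>E \<iota> r}"
      unfolding points[symmetric] points'[symmetric] by (auto simp: open_ball_def appr_def)
    moreover have "\<not> c - c \<preceq> r" using base.zero_le[of r] r val_infty_iff[of r] by auto
    ultimately show "\<not> x - \<iota> c \<preceq>\<^sub>E \<iota> r" by blast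
  next
    assume *: "\<not> x - \<iota> c \<preceq>\<^sub>E \<iota> r"
    then have "open_ball G v \<gamma> c =
        OpenBall \<gamma> {a. vless (grp E) (Fin (emb E \<gamma>)) (val E (x - \<iota> a))}"
      unfolding open_ball_def points points' by (simp add: open_ball_points)
    moreover have "vless (grp E) (Fin (emb E \<gamma>)) (val E (x - \<iota> c))"
      using * by (simp add: emb ext.vless_iff)
    ultimately show "open_ball G v \<gamma> c \<in> appr G v \<iota> E x"
      using \<gamma> by (auto simp: appr_def)
  qed
qed

lemma appr_subset_balls: "appr G v \<iota> E x \<subseteq> balls G v"
proof
  fix B assume B: "B \<in> appr G v \<iota> E x"
  then consider (closed) \<gamma> S where "B = ClosedBall \<gamma> S" "\<gamma> \<in> radii G v" "S \<noteq> {}"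
        "S = {c. vle (grp E) (map_ext_val (emb E) \<gamma>) (val E (x - \<iota> c))}"
    | (opened) \<gamma> S where "B = OpenBall \<gamma> S" "\<gamma> \<in> carrier (value_group G v)" "S \<noteq> {}"
        "S = {c. vless (grp E) (Fin (emb E \<gamma>)) (val E (x - \<iota> c))}"
    unfolding appr_def by blast
  then show "B \<in> balls G v"
  proof cases
    case closed
    then obtain r c where r: "\<gamma> = v r" and c: "c \<in> S" by (auto simp: radii_eq_range)
    have "B = closed_ball G v \<gamma> c"
      using closed c closed_ball_points[of r x c]
      by (simp add: closed_ball_def r val_embedding[symmetric])
    then show ?thesis using closed(2) by (auto simp: balls_def)
  next
    case opened
    then obtain r c where r: "v r = Fin \<gamma>" and c: "c \<in> S" by (auto simp: value_group_def)
    have emb: "Fin (emb E \<gamma>) = val E (\<iota> r)" by (simp add: val_embedding r)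
    have "B = open_ball G v \<gamma> c"
      using opened c open_ball_points[of x c r]
      by (simp add: open_ball_def r[symmetric] vless_iff emb ext.vless_iff)
    then show ?thesis using opened(2) by (auto simp: balls_def)
  qed
qed

text \<open>
  An approximation type consists of balls, so it is known once it is known which balls it contains.
  For \<open>appr\<close> this is decided by comparing \<open>x - \<iota> c\<close> with constants.
\<close>

lemma appr_eqI:
  assumes "A \<subseteq> balls G v"
    and closed: "\<And>r c. closed_ball G v (v r) c \<in> A \<longleftrightarrow> \<iota> r \<preceq>\<^sub>E x - \<iota> c"
    and opened: "\<And>r \<gamma> c. v r = Fin \<gamma> \<Longrightarrow> open_ball G v \<gamma> c \<in> A \<longleftrightarrow> \<not> x - \<iota> c \<preceq>\<^sub>E \<iota> r"
  shows "appr G v \<iota> E x = A"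
proof -
  have "B \<in> appr G v \<iota> E x \<longleftrightarrow> B \<in> A" if "B \<in> balls G v" for B
  proof -
    from that show ?thesis
      by (cases rule: balls_cases) (simp_all add: closed opened closed_ball_in_appr open_ball_in_appr)
  qed
  then show ?thesis using appr_subset_balls assms(1) by blast
qed

text \<open>
  The sets \<open>{c. v (x - c) \<ge> \<gamma>}\<close> and \<open>{c. v (x - c) > \<gamma>}\<close> are preimages of final segments of a
  total order under the same map, which makes any two of them comparable.
\<close>

lemma approximation_type_appr: "approximation_type G v (appr G v \<iota> E x)"
  unfolding approximation_type_def
proof (intro conjI ballI allI impI)
  show "appr G v \<iota> E x \<subseteq> balls G v" by (rule appr_subset_balls)
next
  have up_closed: "\<exists>Q. (\<forall>z w. Q z \<longrightarrow> z \<preceq>\<^sub>E w \<longrightarrow> Q w) \<and> points B = {c. Q (x - \<iota> c)}"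
    if B: "B \<in> appr G v \<iota> E x" for B
  proof -
    have "B \<in> balls G v" using B appr_subset_balls by blast
    then show ?thesis
    proof (cases rule: balls_cases)
      case (closed r c)
      then have "\<iota> r \<preceq>\<^sub>E x - \<iota> c" using B by (simp add: closed_ball_in_appr)
      then have "points B = {c. \<iota> r \<preceq>\<^sub>E x - \<iota> c}"
        using closed by (simp add: closed_ball_def closed_ball_points)
      then show ?thesis
        by (intro exI[of _ "\<lambda>z. \<iota> r \<preceq>\<^sub>E z"]) (auto intro: ext.le_trans)
    next
      case (opened r \<gamma> c)
      then have "\<not> x - \<iota> c \<preceq>\<^sub>E \<iota> r" using B by (simp add: open_ball_in_appr)
      then have "points B = {c. \<not> x - \<iota> c \<preceq>\<^sub>E \<iota> r}"
        unfolding opened(1) open_ball_def by (simp add: vless_iff open_ball_points flip: opened(2))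
      then show ?thesis
        by (intro exI[of _ "\<lambda>z. \<not> z \<preceq>\<^sub>E \<iota> r"]) (auto intro: ext.le_trans)
    qed
  qed
  fix B B' assume "B \<in> appr G v \<iota> E x" "B' \<in> appr G v \<iota> E x"
  from up_closed[OF this(1)] up_closed[OF this(2)] obtain Q Q' where
    Q: "\<And>z w. Q z \<Longrightarrow> z \<preceq>\<^sub>E w \<Longrightarrow> Q w" "points B = {c. Q (x - \<iota> c)}" and
    Q': "\<And>z w. Q' z \<Longrightarrow> z \<preceq>\<^sub>E w \<Longrightarrow> Q' w" "points B' = {c. Q' (x - \<iota> c)}"
    by blast
  show "points B \<subseteq> points B' \<or> points B' \<subseteq> points B"
  proof (rule ccontr)
    assume "\<not> ?thesis"
    then obtain c c' where "Q (x - \<iota> c)" "\<not> Q' (x - \<iota> c)" "Q' (x - \<iota> c')" "\<not> Q (x - \<iota> c')"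
      unfolding Q(2) Q'(2) by blast
    then show False using ext.le_total[of "x - \<iota> c" "x - \<iota> c'"] Q(1) Q'(1) by blast
  qed
next
  fix \<gamma> c \<beta>
  assume "\<gamma> \<in> radii G v" and mem: "closed_ball G v \<gamma> c \<in> appr G v \<iota> E x"
    and "\<beta> \<in> carrier (value_group G v)" and less: "vless G (Fin \<beta>) \<gamma>"
  then obtain r s where r: "\<gamma> = v r" and s: "v s = Fin \<beta>"
    by (auto simp: radii_eq_range value_group_def)
  have "\<not> r \<preceq> s" using less by (simp add: r s[symmetric] vless_iff)
  then have "\<not> \<iota> r \<preceq>\<^sub>E \<iota> s" by (simp add: embedding_le_iff)
  moreover have "\<iota> r \<preceq>\<^sub>E x - \<iota> c" using mem by (simp add: r closed_ball_in_appr)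
  ultimately have "\<not> x - \<iota> c \<preceq>\<^sub>E \<iota> s" using ext.le_trans by blast
  then show "closed_ball G v (Fin \<beta>) c \<in> appr G v \<iota> E x" "open_ball G v \<beta> c \<in> appr G v \<iota> E x"
    using ext.le_total[of "\<iota> s" "x - \<iota> c"]
    by (auto simp: open_ball_in_appr[OF s] closed_ball_in_appr simp flip: s)
next
  fix \<gamma> c
  assume "\<gamma> \<in> carrier (value_group G v)" and mem: "open_ball G v \<gamma> c \<in> appr G v \<iota> E x"
  then obtain r where r: "v r = Fin \<gamma>" by (auto simp: value_group_def)
  have x: "\<not> x - \<iota> c \<preceq>\<^sub>E \<iota> r" using mem by (simp add: open_ball_in_appr[OF r])
  then show "closed_ball G v (Fin \<gamma>) c \<in> appr G v \<iota> E x"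
    using ext.le_total[of "\<iota> r" "x - \<iota> c"] by (auto simp: closed_ball_in_appr simp flip: r)
  fix \<beta> assume "\<beta> \<in> carrier (value_group G v)" and less: "vless G (Fin \<beta>) (Fin \<gamma>)"
  then obtain s where s: "v s = Fin \<beta>" by (auto simp: value_group_def)
  have "s \<preceq> r" using less by (simp add: r s vless_def)
  then have "\<iota> s \<preceq>\<^sub>E \<iota> r" by (simp add: embedding_le_iff)
  then have "\<not> x - \<iota> c \<preceq>\<^sub>E \<iota> s" using x ext.le_trans by blast
  then show "closed_ball G v (Fin \<beta>) c \<in> appr G v \<iota> E x" "open_ball G v \<beta> c \<in> appr G v \<iota> E x"
    using ext.le_total[of "\<iota> s" "x - \<iota> c"]
    by (auto simp: open_ball_in_appr[OF s] closed_ball_in_appr simp flip: s)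
qed

lemma nontrivial_appr:
  assumes "x \<notin> range \<iota>"
  shows "\<not> trivial_appr_type (appr G v \<iota> E x)"
proof -
  have "\<not> vle (grp E) Infty (val E (x - \<iota> c))" for c
    using assms ext.val_infty_iff[of "x - \<iota> c"] by (cases "val E (x - \<iota> c)") auto
  then show ?thesis by (auto simp: trivial_appr_type_def supp_def appr_def)
qed

end


section \<open>Existence of extensions\<close>

context krull_valuation
begin

text \<open>
  The embedding of value groups sends \<open>v a\<close> to the class of \<open>\<iota> a\<close>. The hypothesis on \<open>D\<close> makes this
  independent of the choice of \<open>a\<close>, injective and order preserving.
\<close>

lemma extension_of_preorder:
  fixes \<iota> :: "'k::field \<Rightarrow> 'l::field"
  assumes \<iota>: "field_embedding \<iota>" and D: "valuation_preorder D"
    and D_\<iota>: "\<And>a b. D (\<iota> a) (\<iota> b) \<longleftrightarrow> vle G (v a) (v b)"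
  shows "\<exists>E :: ('l, 'g, 'l set) val_ext. val_extension G v \<iota> E \<and>
    (\<forall>z w. vle (grp E) (val E z) (val E w) \<longleftrightarrow> D z w)"
proof -
  interpret D: field_valuation_preorder D by (simp add: field_valuation_preorder_def D)
  define emb where "emb \<gamma> = value_class D (\<iota> (SOME a. v a = Fin \<gamma>))" for \<gamma>
  define E where "E = \<lparr>grp = class_group D, emb = emb, val = class_val D\<rparr>"
  have cong: "value_class D (\<iota> a) = value_class D (\<iota> b) \<longleftrightarrow> v a = v b" for a b
  proof -
    interpret v: valuation_preorder "\<lambda>a b. vle G (v a) (v b)" by (rule valuation_preorder_val)
    show ?thesis
      unfolding D.value_class_eq_iff D_\<iota> using vle_antisym[of a b] v.le_refl[of a] by auto
  qed
  have emb: "emb \<gamma> = value_class D (\<iota> a)" if "v a = Fin \<gamma>" for a \<gamma>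
  proof -
    have "v (SOME a. v a = Fin \<gamma>) = Fin \<gamma>" using that by (rule someI)
    then show ?thesis unfolding emb_def cong using that by simp
  qed
  have mult: "\<iota> (a * b) = \<iota> a * \<iota> b" and one: "\<iota> 1 = 1" and add: "\<iota> (a + b) = \<iota> a + \<iota> b" for a b
    using \<iota> by (auto simp: field_embedding_def)
  have "\<iota> 0 + \<iota> 0 = \<iota> 0 + 0" using add[of 0 0] by simp
  then have zero: "\<iota> 0 = 0" by (rule add_left_imp_eq)
  have nz: "\<iota> a \<noteq> 0" if "a \<noteq> 0" for a
    using mult[of a "inverse a"] one that by auto
  have val_\<iota>: "class_val D (\<iota> a) = map_ext_val emb (v a)" for a
    using nz[of a] zero val_infty_iff[of a] emb[of a]
    by (cases "v a") (auto simp: class_val_def)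
  have car: "\<exists>a. v a = Fin \<gamma> \<and> a \<noteq> 0" if "\<gamma> \<in> carrier (value_group G v)" for \<gamma>
    using that by (auto simp: value_group_def val_infty_iff[symmetric])
  have "emb \<in> ord_embeddings (value_group G v) (value_group (class_group D) (class_val D))"
    unfolding ord_embeddings_def
  proof (intro CollectI conjI ballI homI inj_onI)
    fix \<alpha> assume "\<alpha> \<in> carrier (value_group G v)"
    then obtain a where a: "v a = Fin \<alpha>" by (auto simp: value_group_def)
    have "class_val D (\<iota> a) = Fin (emb \<alpha>)" by (simp add: val_\<iota> a)
    then show "emb \<alpha> \<in> carrier (value_group (class_group D) (class_val D))"
      by (auto simp: value_group_def)
    fix \<beta> assume "\<beta> \<in> carrier (value_group G v)"
    then obtain b where b: "v b = Fin \<beta>" by (auto simp: value_group_def)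
    have "v (a * b) = Fin (\<alpha> \<otimes>\<^bsub>G\<^esub> \<beta>)" by (simp add: val_mult a b)
    from emb[OF this] show "emb (\<alpha> \<otimes>\<^bsub>value_group G v\<^esub> \<beta>) =
        emb \<alpha> \<otimes>\<^bsub>value_group (class_group D) (class_val D)\<^esub> emb \<beta>"
      by (simp add: value_group_def emb[OF a] emb[OF b] D.value_class_mult mult)
    show "\<alpha> = \<beta>" if "emb \<alpha> = emb \<beta>"
      using that by (simp add: emb[OF a] emb[OF b] cong a b)
    show "gle (value_group G v) \<alpha> \<beta> \<longleftrightarrow>
        gle (value_group (class_group D) (class_val D)) (emb \<alpha>) (emb \<beta>)"
      by (simp add: value_group_def emb[OF a] emb[OF b] D.gle_value_class D_\<iota> a b)
  qed
  then have "val_extension G v \<iota> E"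
    using \<iota> D.krull_valuation_class_val val_\<iota> by (simp add: val_extension_def E_def)
  moreover have "vle (grp E) (val E z) (val E w) \<longleftrightarrow> D z w" for z w
    by (simp add: E_def D.vle_class_val)
  ultimately show ?thesis by blast
qed

lemma field_embedding_ratfun_const: "field_embedding ratfun_const"
  by (simp add: field_embedding_def ratfun_const_def flip: to_fract_add to_fract_mult one_pCons)

text \<open>
  The preorder on \<open>K[x]\<close> that realizes \<open>A\<close> is extended to \<open>K(x)\<close> and turned into a valuation. The case
  \<open>r = 0\<close> is the condition of infinite value for \<open>x - c\<close>, which fails because \<open>x\<close> is not constant and
  is not demanded because \<open>A\<close> is nontrivial.
\<close>

lemma ratfun_extension_exists:
  assumes A: "approximation_type G v A" "\<not> trivial_appr_type A"
  shows "\<exists>E :: ('k::field, 'g) ratfun_ext. val_extension G v ratfun_const E \<and>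
    appr G v ratfun_const E ratfun_X = A"
proof -
  interpret A: nontrivial_approximation G v A
    using A by unfold_locales
  obtain D where D: "valuation_preorder D" and D_const: "\<And>a b. D [:a:] [:b:] \<longleftrightarrow> vle G (v a) (v b)"
    and real: "\<And>k c r. r \<noteq> 0 \<Longrightarrow> A.realizes D (k, c, r) \<longleftrightarrow> A.ball_mem (k, c, r)"
    using A.exists_realizing_order by blast
  interpret D: valuation_preorder D by (rule D)
  obtain E :: "('k, 'g) ratfun_ext" where E: "val_extension G v ratfun_const E"
    and E_le: "\<And>z w. vle (grp E) (val E z) (val E w) \<longleftrightarrow> fract_le D z w"
    using extension_of_preorder[OF field_embedding_ratfun_const D.valuation_preorder_fract_le]
    by (auto simp: ratfun_const_def D.fract_le_to_fract D_const)
  interpret E: valued_field_extension G v ratfun_const E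
    by unfold_locales (rule E)
  have X: "ratfun_X - to_fract [:c:] = to_fract [:- c, 1:]" for c :: 'k
    by (simp add: ratfun_X_def flip: to_fract_diff)
  have "appr G v ratfun_const E ratfun_X = A"
  proof (rule E.appr_eqI)
    show "A \<subseteq> balls G v" using A by (simp add: approximation_type_def)
    show "closed_ball G v (v r) c \<in> A \<longleftrightarrow>
        vle (grp E) (val E (ratfun_const r)) (val E (ratfun_X - ratfun_const c))" for r c
    proof (cases "r = 0")
      case True
      have "closed_ball G v (v r) c \<notin> A"
        using A.radius_nonzero[of False c r] True by (auto simp: A.ball_mem_def)
      moreover have "\<not> D 0 [:- c, 1:]" using D.zero_le[of "[:- c, 1:]"] by auto
      ultimately show ?thesis
        using D.fract_le_to_fract[of 0 "[:- c, 1:]"] True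
        by (simp add: E_le X ratfun_const_def)
    next
      case False
      then show ?thesis
        using real[of r False c]
        by (simp add: E_le X A.ball_mem_def A.realizes_def ratfun_const_def D.fract_le_to_fract)
    qed
    show "open_ball G v \<gamma> c \<in> A \<longleftrightarrow>
        \<not> vle (grp E) (val E (ratfun_X - ratfun_const c)) (val E (ratfun_const r))"
      if "v r = Fin \<gamma>" for r \<gamma> c
    proof -
      have "r \<noteq> 0" using that val_infty_iff[of r] by auto
      then show ?thesis
        using real[of r True c] that
        by (simp add: E_le X A.ball_mem_def A.realizes_def ratfun_const_def D.fract_le_to_fract)
    qed
  qed
  with E show ?thesis by blast
qed

end

lemma ratfun_X_notin_range: "ratfun_X \<notin> range ratfun_const"
  by (auto simp: ratfun_X_def ratfun_const_def)

section \<open>Equivalence of extensions\<close>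

lemma value_group_sel:
  "carrier (value_group G v) = {\<gamma>. \<exists>a. v a = Fin \<gamma>}" "monoid.mult (value_group G v) = monoid.mult G"
  "gle (value_group G v) = gle G"
  by (simp_all add: value_group_def)

lemma ord_isos_iff:
  "f \<in> ord_isos G H \<longleftrightarrow> f \<in> hom G H \<and> bij_betw f (carrier G) (carrier H) \<and>
    (\<forall>\<alpha>\<in>carrier G. \<forall>\<beta>\<in>carrier G. gle G \<alpha> \<beta> \<longleftrightarrow> gle H (f \<alpha>) (f \<beta>))"
  by (auto simp: ord_isos_def iso_def ord_embeddings_def bij_betw_imp_inj_on)

lemma map_ext_val_cong_value:
  assumes "\<And>\<gamma>. \<gamma> \<in> carrier (value_group G v) \<Longrightarrow> f \<gamma> = g \<gamma>"
  shows "map_ext_val f (v z) = map_ext_val g (v z)"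
  using assms by (cases "v z") (auto simp: value_group_sel)

lemma equivalent_over_refl: "equivalent_over G v E E"
  unfolding equivalent_over_def
  by (rule bexI[of _ "\<lambda>x. x"])
    (auto simp: ord_isos_iff hom_def ext_val.map_ident bij_betw_def)

lemma equivalent_over_trans:
  assumes "equivalent_over G v E E'" "equivalent_over G v E' E''"
  shows "equivalent_over G v E E''"
proof -
  obtain f g where f: "f \<in> ord_isos (value_group (grp E) (val E)) (value_group (grp E') (val E'))"
      "\<forall>\<gamma>\<in>carrier (value_group G v). f (emb E \<gamma>) = emb E' \<gamma>"
      "\<forall>z. val E' z = map_ext_val f (val E z)"
    and g: "g \<in> ord_isos (value_group (grp E') (val E')) (value_group (grp E'') (val E''))"
      "\<forall>\<gamma>\<in>carrier (value_group G v). g (emb E' \<gamma>) = emb E'' \<gamma>"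
      "\<forall>z. val E'' z = map_ext_val g (val E' z)"
    using assms unfolding equivalent_over_def by blast
  have "g \<circ> f \<in> ord_isos (value_group (grp E) (val E)) (value_group (grp E'') (val E''))"
    unfolding ord_isos_iff
  proof (intro conjI ballI)
    note iso = f(1)[unfolded ord_isos_iff] g(1)[unfolded ord_isos_iff]
    show "g \<circ> f \<in> hom (value_group (grp E) (val E)) (value_group (grp E'') (val E''))"
      using iso by (auto intro: hom_compose)
    show "bij_betw (g \<circ> f) (carrier (value_group (grp E) (val E)))
        (carrier (value_group (grp E'') (val E'')))"
      using iso by (auto intro: bij_betw_trans)
    fix \<alpha> \<beta>
    assume \<alpha>: "\<alpha> \<in> carrier (value_group (grp E) (val E))"
      and \<beta>: "\<beta> \<in> carrier (value_group (grp E) (val E))"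
    have "f \<in> hom (value_group (grp E) (val E)) (value_group (grp E') (val E'))"
      using iso by simp
    note mem = hom_in_carrier[OF this]
    from mem[OF \<alpha>] mem[OF \<beta>]
    show "gle (value_group (grp E) (val E)) \<alpha> \<beta> \<longleftrightarrow>
        gle (value_group (grp E'') (val E'')) ((g \<circ> f) \<alpha>) ((g \<circ> f) \<beta>)"
      using iso \<alpha> \<beta> by simp
  qed
  then show ?thesis
    unfolding equivalent_over_def
    by (rule bexI[rotated]) (use f g in \<open>auto simp: ext_val.map_comp\<close>)
qed

context valued_field_extension
begin

text \<open>
  The value group of \<open>E\<close> is closed under addition since \<open>val E\<close> is multiplicative; this makes the
  inverse of the isomorphism a homomorphism.
\<close>

lemma equivalent_over_sym:
  assumes "equivalent_over G v E E'"
  shows "equivalent_over G v E' E"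
proof -
  let ?V = "value_group (grp E) (val E)" and ?V' = "value_group (grp E') (val E')"
  obtain f where f: "f \<in> ord_isos ?V ?V'"
      "\<forall>\<gamma>\<in>carrier (value_group G v). f (emb E \<gamma>) = emb E' \<gamma>"
      "\<And>z. val E' z = map_ext_val f (val E z)"
    using assms unfolding equivalent_over_def by blast
  let ?g = "inv_into (carrier ?V) f"
  have bij: "bij_betw f (carrier ?V) (carrier ?V')" and hom: "f \<in> hom ?V ?V'"
    and ord: "\<And>\<alpha> \<beta>. \<alpha> \<in> carrier ?V \<Longrightarrow> \<beta> \<in> carrier ?V \<Longrightarrow> gle ?V \<alpha> \<beta> \<longleftrightarrow> gle ?V' (f \<alpha>) (f \<beta>)"
    using f(1) by (auto simp: ord_isos_iff)
  have gf: "?g (f \<alpha>) = \<alpha>" if "\<alpha> \<in> carrier ?V" for \<alpha>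
    using bij that by (simp add: bij_betw_inv_into_left)
  have surj: "\<exists>\<alpha>\<in>carrier ?V. \<alpha>' = f \<alpha>" if "\<alpha>' \<in> carrier ?V'" for \<alpha>'
    using bij that by (auto simp: bij_betw_def)
  have mult_closed: "\<alpha> \<otimes>\<^bsub>?V\<^esub> \<beta> \<in> carrier ?V" if \<alpha>\<beta>: "\<alpha> \<in> carrier ?V" "\<beta> \<in> carrier ?V" for \<alpha> \<beta>
  proof -
    obtain a b where "val E a = Fin \<alpha>" "val E b = Fin \<beta>" using \<alpha>\<beta> by (auto simp: value_group_sel)
    then have "val E (a * b) = Fin (\<alpha> \<otimes>\<^bsub>grp E\<^esub> \<beta>)" by (simp add: ext.val_mult)
    then show ?thesis by (auto simp: value_group_sel)
  qed
  have "?g \<in> ord_isos ?V' ?V"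
    unfolding ord_isos_iff
  proof (intro conjI ballI homI)
    show "bij_betw ?g (carrier ?V') (carrier ?V)" using bij by (rule bij_betw_inv_into)
    fix \<alpha>' assume "\<alpha>' \<in> carrier ?V'"
    then obtain \<alpha> where \<alpha>: "\<alpha> \<in> carrier ?V" "\<alpha>' = f \<alpha>" using surj by blast
    then show "?g \<alpha>' \<in> carrier ?V" by (simp add: gf)
    fix \<beta>' assume "\<beta>' \<in> carrier ?V'"
    then obtain \<beta> where \<beta>: "\<beta> \<in> carrier ?V" "\<beta>' = f \<beta>" using surj by blast
    show "?g (\<alpha>' \<otimes>\<^bsub>?V'\<^esub> \<beta>') = ?g \<alpha>' \<otimes>\<^bsub>?V\<^esub> ?g \<beta>'"
      using \<alpha> \<beta> gf mult_closed by (simp flip: hom_mult[OF hom])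
    show "gle ?V' \<alpha>' \<beta>' \<longleftrightarrow> gle ?V (?g \<alpha>') (?g \<beta>')"
      using \<alpha> \<beta> gf ord by simp
  qed
  moreover have "?g (emb E' \<gamma>) = emb E \<gamma>" if "\<gamma> \<in> carrier (value_group G v)" for \<gamma>
  proof -
    obtain a where "v a = Fin \<gamma>" using \<open>\<gamma> \<in> _\<close> by (auto simp: value_group_sel)
    then have "val E (\<iota> a) = Fin (emb E \<gamma>)" by (simp add: val_embedding)
    then have "emb E \<gamma> \<in> carrier ?V" by (auto simp: value_group_sel)
    then show ?thesis using gf f(2) that by metis
  qed
  moreover have "val E z = map_ext_val ?g (val E' z)" for z
  proof -
    have "map_ext_val ?g (val E' z) = map_ext_val (\<lambda>\<gamma>. ?g (f \<gamma>)) (val E z)"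
      by (simp add: f(3) ext_val.map_comp comp_def)
    also have "\<dots> = map_ext_val (\<lambda>\<gamma>. \<gamma>) (val E z)"
      using gf by (rule map_ext_val_cong_value)
    finally show ?thesis by (simp add: ext_val.map_ident)
  qed
  ultimately show ?thesis unfolding equivalent_over_def by blast
qed

text \<open>
  Equivalent extensions answer every comparison of values in the same way, hence have the same
  approximation types.
\<close>

lemma vle_equivalent_over:
  assumes "equivalent_over G v E E'"
  shows "vle (grp E') (val E' z) (val E' w) \<longleftrightarrow> z \<preceq>\<^sub>E w"
proof -
  obtain f where f: "\<And>\<alpha> \<beta>. \<alpha> \<in> carrier (value_group (grp E) (val E)) \<Longrightarrow>
        \<beta> \<in> carrier (value_group (grp E) (val E)) \<Longrightarrow>
        gle (grp E) \<alpha> \<beta> \<longleftrightarrow> gle (grp E') (f \<alpha>) (f \<beta>)"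
      "\<And>z. val E' z = map_ext_val f (val E z)"
    using assms by (auto simp: equivalent_over_def ord_isos_iff value_group_sel(3))
  show ?thesis
    unfolding f(2) using f(1) by (cases "val E z"; cases "val E w") (auto simp: value_group_sel)
qed

lemma appr_equivalent_over:
  assumes "val_extension G v \<iota> E'" "equivalent_over G v E E'"
  shows "appr G v \<iota> E x = appr G v \<iota> E' x"
proof -
  interpret E': valued_field_extension G v \<iota> E' by unfold_locales (rule assms(1))
  show ?thesis
    using E'.appr_subset_balls E'.closed_ball_in_appr E'.open_ball_in_appr
    by (intro appr_eqI) (simp_all add: vle_equivalent_over[OF assms(2)])
qed

end

theorem theorem1p2:
  fixes G :: "'g ogroup" and v0 :: "'k::field \<Rightarrow> 'g ext_val"
  assumes "krull_valuation G v0"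
  shows "(\<forall>A. approximation_type G v0 A \<and> \<not> trivial_appr_type A \<longrightarrow>
            (\<exists>E :: ('k, 'g) ratfun_ext. val_extension G v0 ratfun_const E \<and>
               appr G v0 ratfun_const E ratfun_X = A)) \<and>
         equiv (ratfun_extensions G v0) (ratfun_ext_equiv G v0) \<and>
         ratfun_appr G v0 respects ratfun_ext_equiv G v0 \<and>
         (\<lambda>C. the_elem (ratfun_appr G v0 ` C)) `
            (ratfun_extensions G v0 // ratfun_ext_equiv G v0) = nontrivial_appr_types G v0"
proof -
  interpret v0: krull_valuation G v0 by (rule assms)
  have locale_ext: "valued_field_extension G v0 ratfun_const E"
    if "E \<in> ratfun_extensions G v0" for E :: "('k, 'g) ratfun_ext"
    using that by unfold_locales (simp add: ratfun_extensions_def)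
  have exists: "\<exists>E :: ('k, 'g) ratfun_ext. val_extension G v0 ratfun_const E \<and>
      appr G v0 ratfun_const E ratfun_X = A"
    if "approximation_type G v0 A" "\<not> trivial_appr_type A" for A
    using that by (rule v0.ratfun_extension_exists)
  have eq: "equiv (ratfun_extensions G v0) (ratfun_ext_equiv G v0)"
  proof (rule equivI)
    show "ratfun_ext_equiv G v0 \<subseteq> ratfun_extensions G v0 \<times> ratfun_extensions G v0"
      by (auto simp: ratfun_ext_equiv_def)
    show "refl_on (ratfun_extensions G v0) (ratfun_ext_equiv G v0)"
      by (auto simp: refl_on_def ratfun_ext_equiv_def equivalent_over_refl)
    show "sym (ratfun_ext_equiv G v0)"
      using valued_field_extension.equivalent_over_sym[OF locale_ext]
      by (auto simp: sym_def ratfun_ext_equiv_def)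
    show "trans (ratfun_ext_equiv G v0)"
      by (auto simp: trans_def ratfun_ext_equiv_def intro: equivalent_over_trans)
  qed
  have resp: "ratfun_appr G v0 respects ratfun_ext_equiv G v0"
    using valued_field_extension.appr_equivalent_over[OF locale_ext]
    by (auto simp: congruent_def ratfun_ext_equiv_def ratfun_appr_def ratfun_extensions_def)
  have class_image: "ratfun_appr G v0 ` (ratfun_ext_equiv G v0 `` {E}) = {ratfun_appr G v0 E}"
    if "E \<in> ratfun_extensions G v0" for E :: "('k, 'g) ratfun_ext"
  proof -
    have "ratfun_appr G v0 E' = ratfun_appr G v0 E" if "E' \<in> ratfun_ext_equiv G v0 `` {E}" for E'
      using congruentD[OF resp, of E E'] that by simp
    then show ?thesis using equiv_class_self[OF eq that] by blast
  qed
  have "(\<lambda>C. the_elem (ratfun_appr G v0 ` C)) `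
      (ratfun_extensions G v0 // ratfun_ext_equiv G v0) =
      ratfun_appr G v0 ` ratfun_extensions G v0"
    by (auto simp: quotient_def class_image image_iff)
  also have "\<dots> = nontrivial_appr_types G v0"
  proof
    show "ratfun_appr G v0 ` ratfun_extensions G v0 \<subseteq> nontrivial_appr_types G v0"
      using valued_field_extension.approximation_type_appr[OF locale_ext]
        valued_field_extension.nontrivial_appr[OF locale_ext ratfun_X_notin_range]
      by (auto simp: nontrivial_appr_types_def ratfun_appr_def)
    show "nontrivial_appr_types G v0 \<subseteq> ratfun_appr G v0 ` ratfun_extensions G v0"
    proof
      fix A assume "A \<in> nontrivial_appr_types G v0"
      then show "A \<in> ratfun_appr G v0 ` ratfun_extensions G v0"
        using exists[of A]
        by (auto simp: nontrivial_appr_types_def ratfun_appr_def ratfun_extensions_def)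
    qed
  qed
  finally show ?thesis using exists eq resp by blast
qed

end
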